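(* For $\tau\in\mathbb{H}^2$ let $q=e^{2\pi i\tau}$ and $$W=\theta^5\begin{bmatrix}1\\ \frac15\end{bmatrix}(0,\tau)\Big/\theta^5\begin{bmatrix}1\\ \frac35\end{bmatrix}(0,\tau).$$ Then $W$ satisfies the Riccati equation $$q\frac{dW}{dq}=\frac{1}{(\sqrt5)^3}\,\frac{(q;q)_\infty^5}{(q^5;q^5)_\infty}\left(W^2-11W-1\right).$$
   Context: $\mathbb{H}^2$ is the upper half-plane. For $\epsilon,\epsilon'\in\mathbb{R}$, $\theta\begin{bmatrix}\epsilon\\ \epsilon'\end{bmatrix}(\zeta,\tau)=\sum_{n\in\mathbb{Z}}\exp\!\Big(2\pi i\Big[\tfrac12\big(n+\tfrac{\epsilon}{2}\big)^2\tau+\big(n+\tfrac{\epsilon}{2}\big)\big(\zeta+\tfrac{\epsilon'}{2}\big)\Big]\Big)$; $\theta^k$ is the $k$-th power. $(q^k;q^k)_\infty=\prod_{n\ge1}(1-q^{kn})$. The derivative $q\,d/dq$ is understood as $\frac{1}{2\pi i}\frac{d}{d\tau}$. *)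

theory Defs
  imports "HOL-Analysis.Analysis"
begin

definition theta_char :: "real \<Rightarrow> real \<Rightarrow> complex \<Rightarrow> complex \<Rightarrow> complex" where
  "theta_char e e' z t =
     (\<Sum>\<^sub>\<infinity> n::int. exp (2 * pi * \<i> *
        ((1/2) * (of_int n + of_real e / 2)^2 * t + (of_int n + of_real e / 2) * (z + of_real e' / 2))))"

definition qpoch_inf :: "complex \<Rightarrow> nat \<Rightarrow> complex" where
  "qpoch_inf q k = (\<Prod>n. (1 - q ^ (k * Suc n)))"

definition qvar :: "complex \<Rightarrow> complex" where
  "qvar t = exp (2 * pi * \<i> * t)"

definition W5 :: "complex \<Rightarrow> complex" where
  "W5 t = (theta_char 1 (1/5) 0 t) ^ 5 / (theta_char 1 (3/5) 0 t) ^ 5"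

end

(*
  Splitting the summation index modulo 5 gives theta[1;1/5] = c1 A + c3 B and
  theta[1;3/5] = c3 A - c1 B, where A and B are the theta series of 5n + 1/2 and 5n + 3/2 and
  c1 = 2 cos(pi/10), c3 = 2 cos(3 pi/10). The derivative of W is then governed by the Wronskian of
  A and B, which equals 2 pi i eta(5 tau)^6: by Jacobi's formula for eta^3 it is a double sum over
  a square lattice, rearranged along the factorization 5 = (2 + i)(2 - i). On the other side
  W^2 - 11 W - 1 is, up to powers of the thetas, the icosahedral form in A and B, and
  A^10 - 11 A^5 B^5 - B^10 is, up to a constant, the product over the five translates tau + j/5 of
  A^2 - A B - B^2, which the Jacobi triple product evaluates as eta(tau) eta(5 tau).
*)
theory Submission
  imports Defs "HOL-Real_Asymp.Real_Asymp"
begin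

text \<open>The form in W is one in X = theta[1;1/5] and Y = theta[1;3/5], but the translations tau
  -> tau + j/5, which turn such a form into a product, act diagonally only on A and B. The change of
  variables from (A, B) to (X, Y) is therefore central: its matrix squares to c1^2 + c3^2 = 5 times
  the identity, and the form x y (x^10 - 11 x^5 y^5 - y^10) is merely multiplied by 5^6. In A and B
  this form is eta(5 tau)^12, because A B = eta(5 tau) eta(25 tau) and the degree 10 factor is eta(5
  tau)^11 / eta(25 tau). With X Y = sqrt 5 eta(tau) eta(5 tau) and X' Y - X Y' = 10 pi i eta(5
  tau)^6, both sides of the equation become eta products over Y^10; comparing them produces
  eta(tau)^5 / eta(5 tau) and the constant 5^(-3/2).\<close>

section \<open>Summation over the integers\<close>

text \<open>Tannery's theorem along the enumeration \<open>int_decode\<close>. It carries the finite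
  triple product, written as a sum over all integers, to the infinite one without separating
  negative indices.\<close>

lemma tannery_has_sum_int:
  fixes a :: "int \<Rightarrow> nat \<Rightarrow> complex"
  assumes lim: "\<And>j. (\<lambda>n. a j n) \<longlonglongrightarrow> b j"
    and bound: "\<And>j n. norm (a j n) \<le> M j"
    and M: "M summable_on UNIV"
    and sums: "\<And>n. ((\<lambda>j. a j n) has_sum s n) UNIV"
    and s: "s \<longlonglongrightarrow> S"
  shows "(b has_sum S) UNIV"
proof -
  have M': "summable (\<lambda>k. M (int_decode k))"
    by (intro summable_on_imp_summable)
       (use M summable_on_reindex_bij_betw[OF bij_int_decode, of M] in simp)
  have T: "(\<forall>\<^sub>F n in sequentially. summable (\<lambda>k. norm (a (int_decode k) n))) \<and>
           summable (\<lambda>k. norm (b (int_decode k))) \<and>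
           ((\<lambda>n. \<Sum>k. a (int_decode k) n) \<longlonglongrightarrow> (\<Sum>k. b (int_decode k)))"
    by (rule tannerys_theorem[where M = "\<lambda>k. M (int_decode k)"])
       (use lim bound M' in \<open>auto intro!: always_eventually\<close>)
  have "((\<lambda>k. a (int_decode k) n) has_sum s n) UNIV" for n
    using sums[of n] has_sum_reindex_bij_betw[OF bij_int_decode, of "\<lambda>j. a j n" "s n"] by simp
  then have "(\<Sum>k. a (int_decode k) n) = s n" for n
    by (metis has_sum_imp_sums sums_unique)
  then have "(\<Sum>k. b (int_decode k)) = S"
    using T s LIMSEQ_unique by auto
  then have "((\<lambda>k. b (int_decode k)) has_sum S) UNIV"
    using T by (metis norm_summable_imp_has_sum summable_norm_cancel summable_sums)
  then show ?thesis
    using has_sum_reindex_bij_betw[OF bij_int_decode, of b S] by simp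
qed

lemma summable_on_intI:
  fixes f :: "int \<Rightarrow> 'a :: banach"
  assumes "summable (\<lambda>n. norm (f (int n)))" "summable (\<lambda>n. norm (f (- int n - 1)))"
  shows "f summable_on UNIV"
proof -
  have 1: "f summable_on range int"
    using norm_summable_imp_summable_on[OF assms(1)]
    by (subst summable_on_reindex) (auto simp: o_def inj_on_def)
  have 2: "f summable_on range (\<lambda>n. - int n - 1)"
    using norm_summable_imp_summable_on[OF assms(2)]
    by (subst summable_on_reindex) (auto simp: o_def inj_on_def)
  have "range int \<union> range (\<lambda>n. - int n - 1) = UNIV"
  proof -
    have "x \<in> range int \<union> range (\<lambda>n. - int n - 1)" for x
    proof (cases "x \<ge> 0")
      case True then show ?thesis by (metis UnI1 nonneg_int_cases rangeI)
    next
      case False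
      then have "x = - int (nat (- x - 1)) - 1" by simp
      then show ?thesis by blast
    qed
    then show ?thesis by blast
  qed
  moreover have "range int \<inter> range (\<lambda>n. - int n - 1) = {}"
    by auto
  ultimately show ?thesis using summable_on_Un_disjoint[OF 1 2] by simp
qed

text \<open>The weight 1 + x^2 dominates |x|^m for m <= 2, so one Gaussian bound serves the theta
  series, their first moments and their tau-derivatives.\<close>

lemma summable_gauss_int:
  fixes a r y :: real
  assumes "a > 0" "y > 0"
  shows "(\<lambda>n::int. (1 + (a * of_int n + r)\<^sup>2) * exp (- y * (a * of_int n + r)\<^sup>2)) summable_on UNIV"
proof (rule summable_on_intI)
  have *: "summable (\<lambda>n::nat. norm (1 / real n ^ 2))"
    using inverse_power_summable[of 2, where 'a = real] by (simp add: field_simps)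
  have "(\<lambda>n::nat. (1 + (a * real n + r)\<^sup>2) * exp (- y * (a * real n + r)\<^sup>2)) \<in> O(\<lambda>n. 1 / real n ^ 2)"
    using assms by real_asymp
  then show "summable (\<lambda>n. norm ((1 + (a * of_int (int n) + r)\<^sup>2) * exp (- y * (a * of_int (int n) + r)\<^sup>2)))"
    using summable_comparison_test_bigo[OF *] by (simp add: abs_mult)
  have "(\<lambda>n::nat. (1 + (a * (- real n - 1) + r)\<^sup>2) * exp (- y * (a * (- real n - 1) + r)\<^sup>2)) \<in> O(\<lambda>n. 1 / real n ^ 2)"
    using assms by real_asymp
  then show "summable (\<lambda>n. norm ((1 + (a * of_int (- int n - 1) + r)\<^sup>2) * exp (- y * (a * of_int (- int n - 1) + r)\<^sup>2)))"
    using summable_comparison_test_bigo[OF *] by (simp add: abs_mult)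
qed

lemma abs_le_one_plus_square: "\<bar>x\<bar> \<le> 1 + x\<^sup>2" for x :: real
proof -
  have "2 * \<bar>x\<bar> \<le> 1 + x\<^sup>2"
    using zero_le_power2[of "\<bar>x\<bar> - 1"] by (simp add: power2_diff)
  then show ?thesis using abs_ge_zero[of x] by linarith
qed

section \<open>The finite Jacobi triple product\<close>

definition qfin :: "complex \<Rightarrow> nat \<Rightarrow> complex" where
  "qfin q n = (\<Prod>k<n. 1 - q ^ Suc k)"

text \<open>With the convention that the reciprocal vanishes at negative indices, the finite triple product
  becomes a sum over all integers and its recurrences need no boundary cases.\<close>

definition inv_qfin :: "complex \<Rightarrow> int \<Rightarrow> complex" where
  "inv_qfin q m = (if m < 0 then 0 else 1 / qfin q (nat m))"

definition jterm :: "complex \<Rightarrow> complex \<Rightarrow> int \<Rightarrow> complex" where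
  "jterm q z j = (- z) powi j * q powi (j * (j - 1) div 2)"

locale nome =
  fixes q :: complex
  assumes q0: "q \<noteq> 0" and q1: "norm q < 1"
begin

lemma pow_ne_1: "q ^ Suc k \<noteq> 1"
proof
  assume "q ^ Suc k = 1"
  then have "norm q ^ Suc k = 1" by (metis norm_one norm_power)
  moreover have "norm q ^ Suc k < 1" using q1 by (intro power_less_one_iff[THEN iffD2]) auto
  ultimately show False by simp
qed

lemma qfin_nz: "qfin q n \<noteq> 0"
  unfolding qfin_def using pow_ne_1 by (simp del: power_Suc)

lemma inv_qfin_pred: "inv_qfin q (m - 1) = (1 - q powi m) * inv_qfin q m"
proof -
  consider "m < 0" | "m = 0" | k where "m = int (Suc k)"
    using zero_less_imp_eq_int[of m] by (metis gr0_implies_Suc linorder_neqE_linordered_idom)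
  then show ?thesis
  proof cases
    case 3
    have n: "nat m = Suc k" "nat (m - 1) = k" using 3 by auto
    have p: "q powi m = q ^ Suc k" using 3 by (metis power_int_of_nat)
    have "qfin q (Suc k) = qfin q k * (1 - q ^ Suc k)" by (simp add: qfin_def)
    moreover have "1 - q ^ Suc k \<noteq> 0" using pow_ne_1[of k] by simp
    ultimately show ?thesis
      using 3 qfin_nz[of k] qfin_nz[of "Suc k"] unfolding inv_qfin_def n p by (simp add: field_simps del: power_Suc)
  qed (simp_all add: inv_qfin_def)
qed

text \<open>The Gaussian binomial coefficient of 2 n over n + j, extended by zero outside -n <= j <=
  n.\<close>

definition jcoeff :: "nat \<Rightarrow> int \<Rightarrow> complex" where
  "jcoeff n j = qfin q (2 * n) * inv_qfin q (int n + j) * inv_qfin q (int n - j)"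

text \<open>Two q-Pascal steps at once, since the upper index grows by 2. With x = q^(n+j) and y =
  q^(n-j) every coefficient is a polynomial multiple of the reciprocals \<open>u\<close> and
  \<open>v\<close> at the largest indices, so only a polynomial identity in x, y, q remains.\<close>

lemma jcoeff_Suc:
  "jcoeff (Suc n) j = (1 + q powi (2 * int n + 1)) * jcoeff n j
     + q powi (int n - j + 1) * jcoeff n (j - 1) + q powi (int n + j + 1) * jcoeff n (j + 1)"
proof -
  define A where "A = int n + j"
  define B where "B = int n - j"
  define x where "x = q powi A"
  define y where "y = q powi B"
  define u where "u = inv_qfin q (A + 1)"
  define v where "v = inv_qfin q (B + 1)"
  have xy: "q powi (2 * int n) = x * y"
    unfolding x_def y_def A_def B_def using q0 by (simp flip: power_int_add)
  have pA: "q powi (A + 1) = x * q" and pB: "q powi (B + 1) = y * q"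
    using q0 by (simp_all add: x_def y_def power_int_add)
  have p2: "q powi (2 * int n + 1) = x * y * q" using q0 xy by (simp add: power_int_add)
  have a0: "inv_qfin q A = (1 - x * q) * u" using inv_qfin_pred[of "A + 1"] pA by (simp add: u_def)
  have b0: "inv_qfin q B = (1 - y * q) * v" using inv_qfin_pred[of "B + 1"] pB by (simp add: v_def)
  have a1: "inv_qfin q (A - 1) = (1 - x) * (1 - x * q) * u"
    using inv_qfin_pred[of A] a0 by (simp add: x_def)
  have b1: "inv_qfin q (B - 1) = (1 - y) * (1 - y * q) * v"
    using inv_qfin_pred[of B] b0 by (simp add: y_def)
  have Q: "qfin q (2 * Suc n) = qfin q (2 * n) * (1 - x * y * q) * (1 - x * y * q ^ 2)"
  proof -
    have "q ^ (2 * n) = x * y" using xy by (metis of_nat_mult of_nat_numeral power_int_of_nat)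
    then show ?thesis by (simp add: qfin_def power2_eq_square mult_ac)
  qed
  have J0: "jcoeff (Suc n) j = qfin q (2 * n) * (1 - x * y * q) * (1 - x * y * q ^ 2) * u * v"
    unfolding jcoeff_def Q by (simp add: u_def v_def A_def B_def algebra_simps)
  have J1: "jcoeff n j = qfin q (2 * n) * ((1 - x * q) * u) * ((1 - y * q) * v)"
    unfolding jcoeff_def by (simp flip: a0 b0 add: A_def B_def)
  have J2: "jcoeff n (j - 1) = qfin q (2 * n) * ((1 - x) * (1 - x * q) * u) * v"
    unfolding jcoeff_def a1[symmetric] v_def by (simp add: A_def B_def algebra_simps)
  have J3: "jcoeff n (j + 1) = qfin q (2 * n) * u * ((1 - y) * (1 - y * q) * v)"
    unfolding jcoeff_def b1[symmetric] u_def by (simp add: A_def B_def algebra_simps)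
  have J4: "q powi (int n - j + 1) = y * q" "q powi (int n + j + 1) = x * q"
    using pA pB by (simp_all add: A_def B_def)
  have "(1 - x * y * q) * (1 - x * y * q ^ 2) = (1 + x * y * q) * ((1 - x * q) * (1 - y * q))
      + y * q * ((1 - x) * (1 - x * q)) + x * q * ((1 - y) * (1 - y * q))"
    by (simp add: algebra_simps power2_eq_square)
  then have "qfin q (2 * n) * u * v * ((1 - x * y * q) * (1 - x * y * q ^ 2)) =
      qfin q (2 * n) * u * v * ((1 + x * y * q) * ((1 - x * q) * (1 - y * q))
      + y * q * ((1 - x) * (1 - x * q)) + x * q * ((1 - y) * (1 - y * q)))"
    by (rule arg_cong)
  then show ?thesis
    unfolding p2 J0 J1 J2 J3 J4 by (simp only: distrib_left distrib_right mult_ac)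
qed

lemma jcoeff_0: "jcoeff 0 j = (if j = 0 then 1 else 0)"
  by (auto simp: jcoeff_def inv_qfin_def qfin_def)

lemma jterm_shift:
  assumes "z \<noteq> 0"
  shows "z * jterm q z (j - 1) = - (jterm q z j * q powi (1 - j))"
    and "jterm q z (j + 1) / z = - (jterm q z j * q powi j)"
proof -
  have "(j - 1) * (j - 1 - 1) = j * (j - 1) + (1 - j) * 2" by algebra
  then have e: "(j - 1) * (j - 1 - 1) div 2 = j * (j - 1) div 2 + (1 - j)" by simp
  show "z * jterm q z (j - 1) = - (jterm q z j * q powi (1 - j))"
    unfolding jterm_def e using q0 assms by (simp add: power_int_add power_int_diff field_simps)
  have "(j + 1) * (j + 1 - 1) = j * (j - 1) + j * 2" by algebra
  then have e: "(j + 1) * (j + 1 - 1) div 2 = j * (j - 1) div 2 + j" by simp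
  show "jterm q z (j + 1) / z = - (jterm q z j * q powi j)"
    unfolding jterm_def e using q0 assms by (simp add: power_int_add field_simps)
qed

definition jfin :: "complex \<Rightarrow> nat \<Rightarrow> complex" where
  "jfin z n = (\<Prod>k<n. (1 - z * q ^ k) * (1 - q ^ Suc k / z))"

text \<open>This is how multiplication by (1 - z q^n) (1 - q^(n+1) / z) acts on a Laurent series in
  z: the neighbours j - 1 and j + 1 come from the terms with z and 1 / z.\<close>

lemma jcoeff_jterm_Suc:
  assumes "z \<noteq> 0"
  shows "jcoeff (Suc n) j * jterm q z j =
      (1 + q ^ (2 * n + 1)) * (jcoeff n j * jterm q z j)
      - z * q ^ n * (jcoeff n (j - 1) * jterm q z (j - 1))
      - q ^ Suc n / z * (jcoeff n (j + 1) * jterm q z (j + 1))"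
proof -
  have e1: "q powi (2 * int n + 1) = q ^ (2 * n + 1)"
  proof -
    have "2 * int n + 1 = int (2 * n + 1)" by simp
    then show ?thesis by (simp only: power_int_of_nat)
  qed
  have e2: "q powi (int n - j + 1) = q ^ n * q powi (1 - j)"
    using q0 by (simp add: power_int_add power_int_diff)
  have e3: "q powi (int n + j + 1) = q ^ Suc n * q powi j"
    using q0 by (simp add: power_int_add)
  have r: "(1 + q ^ (2 * n + 1)) * (jcoeff n j * jterm q z j)
      - z * q ^ n * (jcoeff n (j - 1) * jterm q z (j - 1))
      - q ^ Suc n / z * (jcoeff n (j + 1) * jterm q z (j + 1)) =
      (1 + q ^ (2 * n + 1)) * (jcoeff n j * jterm q z j)
      - q ^ n * jcoeff n (j - 1) * (z * jterm q z (j - 1))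
      - q ^ Suc n * jcoeff n (j + 1) * (jterm q z (j + 1) / z)"
    by (simp add: mult_ac)
  show ?thesis
    unfolding r jcoeff_Suc e1 e2 e3 jterm_shift[OF assms]
    by (simp only: mult_minus_right diff_minus_eq_add distrib_left distrib_right mult_ac)
qed

lemma has_sum_shift_int:
  fixes f :: "int \<Rightarrow> complex"
  shows "((\<lambda>j. f (j + c)) has_sum S) UNIV \<longleftrightarrow> (f has_sum S) UNIV"
  by (rule has_sum_reindex_bij_witness[of _ "\<lambda>j. j - c" "\<lambda>j. j + c"]) auto

lemma finite_jacobi:
  assumes "z \<noteq> 0"
  shows "((\<lambda>j. jcoeff n j * jterm q z j) has_sum jfin z n) UNIV"
proof (induction n)
  case 0
  have "((\<lambda>j. jcoeff 0 j * jterm q z j) has_sum 1) UNIV"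
    by (rule has_sum_finite_neutralI[of "{0}"]) (auto simp: jcoeff_0 jterm_def)
  then show ?case by (simp add: jfin_def)
next
  case (Suc n)
  let ?f = "\<lambda>j. jcoeff n j * jterm q z j"
  have m: "((\<lambda>j. ?f (j - 1)) has_sum jfin z n) UNIV" "((\<lambda>j. ?f (j + 1)) has_sum jfin z n) UNIV"
    using Suc has_sum_shift_int[of ?f "-1"] has_sum_shift_int[of ?f 1] by simp_all
  have "((\<lambda>j. (1 + q ^ (2 * n + 1)) * ?f j + (- (z * q ^ n)) * ?f (j - 1)
          + (- (q ^ Suc n / z)) * ?f (j + 1)) has_sum
        ((1 + q ^ (2 * n + 1)) * jfin z n + (- (z * q ^ n)) * jfin z n
          + (- (q ^ Suc n / z)) * jfin z n)) UNIV"
    by (intro has_sum_add has_sum_cmult_right Suc m)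
  also have "(1 + q ^ (2 * n + 1)) * jfin z n + (- (z * q ^ n)) * jfin z n
          + (- (q ^ Suc n / z)) * jfin z n = jfin z (Suc n)"
  proof -
    have "jfin z (Suc n) = jfin z n * ((1 - z * q ^ n) * (1 - q ^ Suc n / z))"
      by (simp add: jfin_def)
    also have "(1 - z * q ^ n) * (1 - q ^ Suc n / z) = 1 + q ^ (2 * n + 1) - z * q ^ n - q ^ Suc n / z"
      using assms by (simp add: field_simps mult_2_right power_add)
    finally show ?thesis by (simp add: algebra_simps)
  qed
  finally show ?case by (simp add: jcoeff_jterm_Suc[OF assms])
qed

text \<open>This is the derivative at \<open>z = 1\<close> of the finite triple product, obtained by summing the recurrence
  for the coefficients instead of differentiating.\<close>

lemma finite_jacobi_deriv:
  "((\<lambda>j. of_int j * (jcoeff (Suc n) j * jterm q 1 j)) has_sum (- qfin q n * qfin q (Suc n))) UNIV"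
proof -
  have step: "((\<lambda>j. of_int j * (jcoeff (Suc n) j * jterm q 1 j)) has_sum
      ((1 - q ^ n) * (1 - q ^ Suc n) * D - (q ^ n - q ^ Suc n) * jfin 1 n)) UNIV"
    if D: "((\<lambda>j. of_int j * (jcoeff n j * jterm q 1 j)) has_sum D) UNIV" for n D
  proof -
    let ?f = "\<lambda>j. jcoeff n j * jterm q 1 j"
    let ?g = "\<lambda>j. of_int j * (jcoeff n j * jterm q 1 j)"
    note F = finite_jacobi[of 1 n, simplified]
    have m: "((\<lambda>j. ?f (j - 1)) has_sum jfin 1 n) UNIV" "((\<lambda>j. ?f (j + 1)) has_sum jfin 1 n) UNIV"
      "((\<lambda>j. ?g (j - 1)) has_sum D) UNIV" "((\<lambda>j. ?g (j + 1)) has_sum D) UNIV"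
      using F D has_sum_shift_int[of ?f "-1"] has_sum_shift_int[of ?f 1]
        has_sum_shift_int[of ?g "-1"] has_sum_shift_int[of ?g 1] by simp_all
    have "((\<lambda>j. (1 + q ^ (2 * n + 1)) * ?g j + (- (q ^ n)) * (?g (j - 1) + ?f (j - 1))
          + (- (q ^ Suc n)) * (?g (j + 1) + (- 1) * ?f (j + 1))) has_sum
        ((1 + q ^ (2 * n + 1)) * D + (- (q ^ n)) * (D + jfin 1 n)
          + (- (q ^ Suc n)) * (D + (- 1) * jfin 1 n))) UNIV"
      by (intro has_sum_add has_sum_cmult_right D m)
    also have "(\<lambda>j. (1 + q ^ (2 * n + 1)) * ?g j + (- (q ^ n)) * (?g (j - 1) + ?f (j - 1))
          + (- (q ^ Suc n)) * (?g (j + 1) + (- 1) * ?f (j + 1))) =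
          (\<lambda>j. of_int j * (jcoeff (Suc n) j * jterm q 1 j))"
      by (rule ext, subst jcoeff_jterm_Suc) (simp_all add: algebra_simps)
    also have "(1 + q ^ (2 * n + 1)) * D + (- (q ^ n)) * (D + jfin 1 n)
          + (- (q ^ Suc n)) * (D + (- 1) * jfin 1 n) =
       (1 - q ^ n) * (1 - q ^ Suc n) * D - (q ^ n - q ^ Suc n) * jfin 1 n"
      by (simp add: algebra_simps mult_2_right power_add)
    finally show ?thesis .
  qed
  show ?thesis
  proof (induction n)
    case 0
    \<comment> \<open>Only this first step sees a nonzero \<open>jfin 1 n\<close>, namely
      \<open>jfin 1 0 = 1\<close>, and it produces the value -(1 - q); later the factor with k = 0
      makes it vanish. Hence the sum is stated for \<open>Suc n\<close>.\<close>
    have "((\<lambda>j. of_int j * (jcoeff 0 j * jterm q 1 j)) has_sum 0) UNIV"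
      by (rule has_sum_finite_neutralI[of "{}"]) (auto simp: jcoeff_0)
    from step[OF this] show ?case by (simp add: jfin_def qfin_def)
  next
    case (Suc n)
    have "jfin 1 (Suc n) = 0" unfolding jfin_def by (rule prod_zero) (auto intro: bexI[of _ 0])
    then show ?case using step[OF Suc] by (simp add: qfin_def algebra_simps)
  qed
qed

end

section \<open>The Jacobi triple product and the cube of the Euler function\<close>

definition qprod :: "complex \<Rightarrow> complex \<Rightarrow> complex" where
  "qprod a q = (\<Prod>k. 1 - a * q ^ k)"

context nome
begin

section \<open>Convergence of the finite products and of their coefficients\<close>

lemma qprod_has_prod: "(\<lambda>k. 1 - a * q ^ k) has_prod qprod a q"
proof -
  have "summable (\<lambda>k. norm a * norm q ^ k)"
    by (intro summable_mult summable_geometric) (use q1 in simp)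
  then have "summable (\<lambda>k. norm ((1 - a * q ^ k) - 1))"
    by (simp add: norm_mult norm_power)
  then have "convergent_prod (\<lambda>k. 1 - a * q ^ k)"
    by (intro abs_convergent_prod_imp_convergent_prod summable_imp_abs_convergent_prod)
  then show ?thesis
    unfolding qprod_def by (simp add: convergent_prod_has_prod_iff)
qed

lemma qprod_lim: "(\<lambda>n. \<Prod>k<n. 1 - a * q ^ k) \<longlonglongrightarrow> qprod a q"
  by (rule has_prod_imp_tendsto'[OF qprod_has_prod])

lemma qpoch_eq_qprod: "qpoch_inf q 1 = qprod q q"
  by (simp add: qpoch_inf_def qprod_def)

lemma qfin_lim: "qfin q \<longlonglongrightarrow> qpoch_inf q 1"
  using qprod_lim[of q] unfolding qpoch_eq_qprod qfin_def by simp

lemma qpoch_nz: "qpoch_inf q 1 \<noteq> 0"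
proof -
  have "1 - q * q ^ k \<noteq> 0" for k using pow_ne_1[of k] by simp
  then show ?thesis
    unfolding qpoch_eq_qprod using has_prod_eq_0_iff[OF qprod_has_prod[of q]] by auto
qed

lemma jfin_lim: "(\<lambda>n. jfin z n) \<longlonglongrightarrow> qprod z q * qprod (q / z) q"
proof -
  have "jfin z n = (\<Prod>k<n. 1 - z * q ^ k) * (\<Prod>k<n. 1 - (q / z) * q ^ k)" for n
    unfolding jfin_def prod.distrib by simp
  then show ?thesis using tendsto_mult[OF qprod_lim[of z] qprod_lim[of "q / z"]] by simp
qed

lemma jcoeff_lim: "(\<lambda>n. jcoeff n j) \<longlonglongrightarrow> 1 / qpoch_inf q 1"
proof -
  have a: "(\<lambda>n. inv_qfin q (int n + i)) \<longlonglongrightarrow> 1 / qpoch_inf q 1" for i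
  proof (rule Lim_transform_eventually)
    have "filterlim (\<lambda>n. nat (int n + i)) sequentially sequentially"
      unfolding filterlim_at_top eventually_sequentially
    proof (intro allI exI impI)
      fix Z n assume "nat (int Z - i) \<le> n"
      then show "Z \<le> nat (int n + i)" by linarith
    qed
    then show "(\<lambda>n. 1 / qfin q (nat (int n + i))) \<longlonglongrightarrow> 1 / qpoch_inf q 1"
      by (intro tendsto_divide tendsto_const qpoch_nz filterlim_compose[OF qfin_lim])
    have "1 / qfin q (nat (int n + i)) = inv_qfin q (int n + i)" if "n \<ge> nat (- i)" for n
      using that by (auto simp: inv_qfin_def)
    then show "\<forall>\<^sub>F n in sequentially. 1 / qfin q (nat (int n + i)) = inv_qfin q (int n + i)"
      unfolding eventually_sequentially by blast
  qed
  have "filterlim (\<lambda>n::nat. 2 * n) sequentially sequentially"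
    by (rule filterlim_subseq) (simp add: strict_mono_def)
  then have b: "(\<lambda>n. qfin q (2 * n)) \<longlonglongrightarrow> qpoch_inf q 1"
    by (rule filterlim_compose[OF qfin_lim])
  have "(\<lambda>n. qfin q (2 * n) * inv_qfin q (int n + j) * inv_qfin q (int n + - j)) \<longlonglongrightarrow>
        qpoch_inf q 1 * (1 / qpoch_inf q 1) * (1 / qpoch_inf q 1)"
    by (intro tendsto_mult a b)
  then show ?thesis using qpoch_nz by (simp add: jcoeff_def)
qed

lemma jcoeff_bounded: obtains B where "\<And>n j. norm (jcoeff n j) \<le> B"
proof -
  obtain U where U: "U > 0" "\<And>n. norm (qfin q n) \<le> U"
    using convergent_imp_Bseq[OF convergentI[OF qfin_lim]] by (auto elim: BseqE)
  have "(\<lambda>n. 1 / qfin q n) \<longlonglongrightarrow> 1 / qpoch_inf q 1"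
    by (intro tendsto_divide tendsto_const qfin_lim qpoch_nz)
  then obtain L where L: "L > 0" "\<And>n. norm (1 / qfin q n) \<le> L"
    using convergent_imp_Bseq[OF convergentI] by (metis BseqE)
  have L': "norm (inv_qfin q m) \<le> L" for m
    using L by (auto simp: inv_qfin_def)
  have "norm (jcoeff n j) \<le> U * L * L" for n j
    unfolding jcoeff_def norm_mult using U L L' by (intro mult_mono) auto
  then show ?thesis by (rule that)
qed

text \<open>Completing the square: with c = ln |q| < 0 the exponent j ln |z| + c j (j - 1) / 2 is (c
  / 2) (j + r)^2 up to a constant, where r = ln |z| / c - 1/2. The factor 1 + |j| prepares the
  weighted series of the cube.\<close>

lemma jterm_summable:
  assumes "z \<noteq> 0"
  shows "(\<lambda>j. (1 + \<bar>of_int j\<bar>) * norm (jterm q z j)) summable_on UNIV"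
proof -
  define c where "c = ln (norm q)"
  define d where "d = ln (norm z)"
  define r where "r = d / c - 1 / 2"
  have c: "c < 0" using q0 q1 by (simp add: c_def)
  have nj: "norm (jterm q z j) = exp (- (c / 2) * r\<^sup>2) * exp (- (- c / 2) * (1 * of_int j + r)\<^sup>2)" for j
  proof -
    have "even (j * (j - 1))" by simp
    then obtain k where k: "j * (j - 1) = 2 * k" by (rule evenE)
    then have "real_of_int j * (of_int j - 1) = 2 * of_int k"
      by (metis of_int_1 of_int_diff of_int_mult of_int_numeral)
    with k have h: "real_of_int (j * (j - 1) div 2) = of_int j * (of_int j - 1) / 2"
      by simp
    have e: "x powi i = exp (of_int i * ln x)" if "x > 0" for x :: real and i
      using that exp_power_int[of "ln x" i] by simp
    have "norm (jterm q z j) = exp (of_int j * d) * exp (of_int (j * (j - 1) div 2) * c)"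
      unfolding jterm_def norm_mult norm_power_int using q0 assms
      by (simp add: c_def d_def e)
    also have "\<dots> = exp (of_int j * d + of_int j * (of_int j - 1) / 2 * c)"
      unfolding h by (simp add: exp_add)
    also have "of_int j * d + of_int j * (of_int j - 1) / 2 * c =
        - (c / 2) * r\<^sup>2 + - (- c / 2) * (1 * of_int j + r)\<^sup>2"
      using c unfolding r_def by (simp add: field_simps power2_eq_square)
    finally show ?thesis by (simp only: exp_add)
  qed
  have S: "(\<lambda>j::int. ((2 + \<bar>r\<bar>) * exp (- (c / 2) * r\<^sup>2)) *
      ((1 + (1 * of_int j + r)\<^sup>2) * exp (- (- c / 2) * (1 * of_int j + r)\<^sup>2))) summable_on UNIV"
    using c by (intro summable_on_cmult_right summable_gauss_int) auto
  show ?thesis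
  proof (rule summable_on_comparison_test[OF S])
    fix j :: int
    let ?x = "of_int j + r"
    have "1 + \<bar>real_of_int j\<bar> \<le> (2 + \<bar>r\<bar>) + ?x\<^sup>2"
      using abs_le_one_plus_square[of ?x] by linarith
    also have "\<dots> \<le> (2 + \<bar>r\<bar>) * (1 + ?x\<^sup>2)"
      by (simp add: algebra_simps)
    finally have "1 + \<bar>real_of_int j\<bar> \<le> (2 + \<bar>r\<bar>) * (1 + ?x\<^sup>2)" .
    then have "(1 + \<bar>real_of_int j\<bar>) * norm (jterm q z j) \<le> (2 + \<bar>r\<bar>) * (1 + ?x\<^sup>2) * norm (jterm q z j)"
      by (rule mult_right_mono) simp
    then show "(1 + \<bar>real_of_int j\<bar>) * norm (jterm q z j) \<le> ((2 + \<bar>r\<bar>) * exp (- (c / 2) * r\<^sup>2)) *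
      ((1 + (1 * of_int j + r)\<^sup>2) * exp (- (- c / 2) * (1 * of_int j + r)\<^sup>2))"
      unfolding nj by (simp add: mult_ac)
  qed simp_all
qed

text \<open>The weight \<open>w\<close> and the offset \<open>m\<close> let one limit argument serve
  two series: w = 1, m = 0 for the triple product and w = j, m = 1 for its derivative at z = 1. The
  factor \<open>qpoch_inf q 1\<close> compensates the limit of the coefficients.\<close>

lemma jterm_limit:
  assumes "z \<noteq> 0" and "\<And>j. norm (w j) \<le> 1 + \<bar>of_int j\<bar>"
    and sums: "\<And>n. ((\<lambda>j. w j * (jcoeff (n + m) j * jterm q z j)) has_sum s n) UNIV"
    and s: "s \<longlonglongrightarrow> S"
  shows "((\<lambda>j. w j * jterm q z j) has_sum (qpoch_inf q 1 * S)) UNIV"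
proof -
  obtain B where B: "\<And>n j. norm (jcoeff n j) \<le> B" using jcoeff_bounded by blast
  have "((\<lambda>j. w j * (1 / qpoch_inf q 1 * jterm q z j)) has_sum S) UNIV"
  proof (rule tannery_has_sum_int[OF _ _ _ sums s])
    show "(\<lambda>n. w j * (jcoeff (n + m) j * jterm q z j)) \<longlonglongrightarrow> w j * (1 / qpoch_inf q 1 * jterm q z j)" for j
      using LIMSEQ_ignore_initial_segment[OF jcoeff_lim] by (intro tendsto_intros)
    show "(\<lambda>j. B * ((1 + \<bar>of_int j\<bar>) * norm (jterm q z j))) summable_on UNIV"
      by (intro summable_on_cmult_right jterm_summable assms)
    show "norm (w j * (jcoeff (n + m) j * jterm q z j)) \<le> B * ((1 + \<bar>of_int j\<bar>) * norm (jterm q z j))" for j n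
    proof -
      have "norm (w j) * norm (jcoeff (n + m) j) \<le> (1 + \<bar>of_int j\<bar>) * B"
        by (intro mult_mono assms B) auto
      then have "norm (w j) * norm (jcoeff (n + m) j) * norm (jterm q z j) \<le> (1 + \<bar>of_int j\<bar>) * B * norm (jterm q z j)"
        by (rule mult_right_mono) simp
      then show ?thesis by (simp add: norm_mult mult_ac)
    qed
  qed
  from has_sum_cmult_right[OF this, of "qpoch_inf q 1"] show ?thesis
    using qpoch_nz by (simp add: mult_ac)
qed

theorem jacobi_triple_product:
  assumes "z \<noteq> 0"
  shows "(jterm q z has_sum (qpoch_inf q 1 * (qprod z q * qprod (q / z) q))) UNIV"
  using jterm_limit[OF assms, of "\<lambda>_. 1" 0 "jfin z"] finite_jacobi[OF assms] jfin_lim[of z] by simp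

text \<open>Two of the three Euler products come from the limit of
  \<open>finite_jacobi_deriv\<close>, the third from the normalisation in
  \<open>jterm_limit\<close>.\<close>

theorem jacobi_cube:
  "((\<lambda>j. of_int j * jterm q 1 j) has_sum (- (qpoch_inf q 1 ^ 3))) UNIV"
proof -
  have "(\<lambda>n. - qfin q n * qfin q (Suc n)) \<longlonglongrightarrow> - qpoch_inf q 1 * qpoch_inf q 1"
    by (intro tendsto_intros qfin_lim LIMSEQ_Suc)
  from jterm_limit[OF _ _ _ this, of 1 of_int 1] finite_jacobi_deriv
  show ?thesis by (simp add: power3_eq_cube mult_ac norm_of_int)
qed

end

section \<open>Alternating theta series on arithmetic progressions\<close>

text \<open>The sign is the one that the characteristics 1/5 and 3/5 produce when the summation
  index moves by 5, and also the one in the series of eta^3. The power m is 0 for the theta series,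
  2 for its tau-derivative up to pi i, and 1 for eta^3.\<close>

definition gterm :: "real \<Rightarrow> real \<Rightarrow> nat \<Rightarrow> complex \<Rightarrow> int \<Rightarrow> complex" where
  "gterm a r m \<tau> n = (- 1) powi n * of_real (a * of_int n + r) ^ m
     * exp (of_real pi * \<i> * \<tau> * of_real (a * of_int n + r) ^ 2)"

definition gsum :: "real \<Rightarrow> real \<Rightarrow> nat \<Rightarrow> complex \<Rightarrow> complex" where
  "gsum a r m \<tau> = (\<Sum>\<^sub>\<infinity>n. gterm a r m \<tau> n)"

lemma norm_gterm_le:
  assumes "m \<le> 2" "0 < y" "y \<le> Im \<tau>"
  shows "norm (gterm a r m \<tau> n) \<le> (1 + (a * of_int n + r)\<^sup>2) * exp (- (pi * y) * (a * of_int n + r)\<^sup>2)"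
proof -
  let ?x = "a * of_int n + r"
  have n1: "norm ((- 1 :: complex) powi n) = 1" by (simp add: norm_power_int)
  have "Re (of_real pi * \<i> * \<tau> * of_real ?x ^ 2) = - (pi * Im \<tau>) * ?x\<^sup>2"
    by (simp flip: of_real_power)
  then have "norm (gterm a r m \<tau> n) = \<bar>?x\<bar> ^ m * exp (- (pi * Im \<tau>) * ?x\<^sup>2)"
    unfolding gterm_def norm_mult n1 norm_power norm_exp_eq_Re norm_of_real by simp
  also have "\<dots> \<le> (1 + ?x\<^sup>2) * exp (- (pi * y) * ?x\<^sup>2)"
  proof (rule mult_mono)
    have "m = 0 \<or> m = 1 \<or> m = 2" using assms by linarith
    then show "\<bar>?x\<bar> ^ m \<le> 1 + ?x\<^sup>2" using abs_le_one_plus_square[of ?x] by (elim disjE) simp_all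
    have "pi * y * ?x\<^sup>2 \<le> pi * Im \<tau> * ?x\<^sup>2" using assms by (intro mult_right_mono) auto
    then show "exp (- (pi * Im \<tau>) * ?x\<^sup>2) \<le> exp (- (pi * y) * ?x\<^sup>2)" by simp
  qed auto
  finally show ?thesis .
qed

lemma gterm_abs_summable:
  assumes "a > 0" "m \<le> 2" "Im \<tau> > 0"
  shows "(\<lambda>n. norm (gterm a r m \<tau> n)) summable_on UNIV"
proof (rule summable_on_comparison_test)
  show "(\<lambda>n::int. (1 + (a * of_int n + r)\<^sup>2) * exp (- (pi * Im \<tau>) * (a * of_int n + r)\<^sup>2)) summable_on UNIV"
    using assms by (intro summable_gauss_int) auto
  show "norm (gterm a r m \<tau> n) \<le> (1 + (a * of_int n + r)\<^sup>2) * exp (- (pi * Im \<tau>) * (a * of_int n + r)\<^sup>2)" for n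
    by (rule norm_gterm_le) (use assms in auto)
qed simp_all

lemma gsum_has_sum:
  assumes "a > 0" "m \<le> 2" "Im \<tau> > 0"
  shows "(gterm a r m \<tau> has_sum gsum a r m \<tau>) UNIV"
  unfolding gsum_def
  by (rule has_sum_infsum[OF abs_summable_summable[OF gterm_abs_summable[OF assms]]])

lemma gsum_sums:
  assumes "a > 0" "m \<le> 2" "Im \<tau> > 0"
  shows "(\<lambda>k. gterm a r m \<tau> (int_decode k)) sums gsum a r m \<tau>"
proof -
  have "((\<lambda>k. gterm a r m \<tau> (int_decode k)) has_sum gsum a r m \<tau>) UNIV"
    using gsum_has_sum[OF assms]
    by (rule has_sum_reindex_bij_betw[OF bij_int_decode, THEN iffD2])
  then show ?thesis by (rule has_sum_imp_sums)
qed

text \<open>Termwise differentiation on the half-plane Im t > Im tau / 2, where half the height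
  still gives a summable bound independent of t; each term brings down pi i (a n + r)^2.\<close>

lemma gsum_deriv:
  assumes a: "a > 0" and t: "Im \<tau> > 0"
  shows "(gsum a r 0 has_field_derivative (of_real pi * \<i> * gsum a r 2 \<tau>)) (at \<tau>)"
proof -
  define S where "S = {t. Im t > Im \<tau> / 2}"
  define f where "f = (\<lambda>k t. gterm a r 0 t (int_decode k))"
  define f' where "f' = (\<lambda>k t. of_real pi * \<i> * gterm a r 2 t (int_decode k))"
  define M where "M = (\<lambda>n::int. (1 + (a * of_int n + r)\<^sup>2) * exp (- (pi * (Im \<tau> / 2)) * (a * of_int n + r)\<^sup>2))"
  have S: "convex S" "open S" "\<tau> \<in> S"
    unfolding S_def using t by (auto intro: convex_halfspace_Im_gt open_halfspace_Im_gt simp del: less_divide_eq_numeral1 divide_less_eq_numeral1)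
  have "M summable_on UNIV"
    unfolding M_def using a t by (intro summable_gauss_int) auto
  then have M: "summable (\<lambda>k. pi * M (int_decode k))"
    by (intro summable_mult summable_on_imp_summable)
       (simp add: summable_on_reindex_bij_betw[OF bij_int_decode, of M])
  have "uniformly_convergent_on S (\<lambda>n t. \<Sum>k<n. f' k t)"
  proof (rule Weierstrass_m_test'[OF _ M])
    fix k t assume "t \<in> S"
    then have "norm (gterm a r 2 t (int_decode k)) \<le> M (int_decode k)"
      unfolding M_def using \<open>Im \<tau> > 0\<close> by (intro norm_gterm_le) (auto simp: S_def)
    then show "norm (f' k t) \<le> pi * M (int_decode k)" by (simp add: f'_def norm_mult)
  qed
  moreover have "(f k has_field_derivative f' k t) (at t within S)" for k t
    unfolding f_def f'_def gterm_def by (auto intro!: derivative_eq_intros simp: mult_ac)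
  moreover have sm: "(\<lambda>k. f k t) sums gsum a r 0 t" if "t \<in> S" for t
    unfolding f_def using that a t by (intro gsum_sums) (auto simp: S_def)
  ultimately have "((\<lambda>t. \<Sum>k. f k t) has_field_derivative (\<Sum>k. f' k \<tau>)) (at \<tau>)"
    using S by (intro has_field_derivative_series'(2)[of S f f' \<tau>])
      (auto simp: interior_open dest: sums_summable)
  moreover have "(\<Sum>k. f' k \<tau>) = of_real pi * \<i> * gsum a r 2 \<tau>"
    using sums_mult[OF gsum_sums[of a 2 \<tau> r], of "of_real pi * \<i>"] a t
    unfolding f'_def by (simp add: sums_iff)
  moreover have "(\<Sum>k. f k t) = gsum a r 0 t" if "t \<in> S" for t
    using sm[OF that] by (simp add: sums_iff)
  ultimately show ?thesis
    using has_field_derivative_transform_within_open[of "\<lambda>t. \<Sum>k. f k t" _ \<tau> S "gsum a r 0"] S by simp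
qed

section \<open>Symmetries, triple product form and double sums of the alternating series\<close>

lemma gsum_uminus: "even m \<Longrightarrow> gsum a (- r) m \<tau> = gsum a r m \<tau>"
  unfolding gsum_def
proof (rule infsum_reindex_bij_witness[of _ uminus uminus])
  fix n :: int assume "even m"
  have e: "a * of_int (- n) + r = - (a * of_int n + - r)" by simp
  have "(- 1 :: complex) powi (- n) = (- 1) powi n" by (simp add: power_int_minus power_int_minus_left)
  then show "gterm a r m \<tau> (- n) = gterm a (- r) m \<tau> n"
    unfolding gterm_def e of_real_minus using \<open>even m\<close> by (simp only: power2_minus power_minus_even)
qed auto

text \<open>For a = 5 and even m, this and evenness reduce every half-odd offset to 1/2, 3/2 or 5/2
  up to sign, and force the series with offset 5/2 to vanish.\<close>

lemma gsum_shift: "gsum a (r + a) m \<tau> = - gsum a r m \<tau>"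
proof -
  have "gsum a (r + a) m \<tau> = (\<Sum>\<^sub>\<infinity>n. - gterm a r m \<tau> n)"
    unfolding gsum_def
  proof (rule infsum_reindex_bij_witness[of _ "\<lambda>n. n - 1" "\<lambda>n. n + 1"])
    fix n :: int
    have e: "a * of_int (n + 1) + r = a * of_int n + (r + a)" by (simp add: algebra_simps)
    have "(- 1 :: complex) powi (n + 1) = - ((- 1) powi n)" by (simp add: power_int_add)
    then show "- gterm a r m \<tau> (n + 1) = gterm a (r + a) m \<tau> n"
      unfolding gterm_def e by simp
  qed auto
  then show ?thesis by (simp add: gsum_def infsum_uminus)
qed

text \<open>From (a n + r)^2 = r^2 + n (2 a r + a^2) + n (n - 1) a^2, where the even number n (n -
  1) matches the triangular exponent of \<open>jterm\<close>.\<close>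

lemma gterm_eq_jterm:
  "gterm a r 0 \<tau> n = exp (of_real pi * \<i> * \<tau> * of_real r ^ 2) *
     jterm (exp (2 * of_real pi * \<i> * \<tau> * of_real a ^ 2))
           (exp (of_real pi * \<i> * \<tau> * of_real (2 * a * r + a ^ 2))) n"
proof -
  have "even (n * (n - 1))" by simp
  then obtain k where k: "n * (n - 1) = 2 * k" by (rule evenE)
  then have k': "complex_of_int n * (of_int n - 1) = 2 * of_int k"
    by (metis of_int_1 of_int_diff of_int_mult of_int_numeral)
  have "(- exp z :: complex) powi n = (- 1) powi n * exp (of_int n * z)" for z
    using power_int_mult_distrib[of "- 1" "exp z" n] by (simp add: exp_power_int)
  moreover have "exp z powi (n * (n - 1) div 2) = exp (of_int k * z)" for z :: complex
    using k by (simp add: exp_power_int)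
  moreover have "of_real pi * \<i> * \<tau> * of_real (a * of_int n + r) ^ 2 =
      of_real pi * \<i> * \<tau> * of_real r ^ 2 +
      (of_int n * (of_real pi * \<i> * \<tau> * of_real (2 * a * r + a ^ 2)) +
       of_int k * (2 * of_real pi * \<i> * \<tau> * of_real a ^ 2))"
  proof -
    have "of_int k * (2 * of_real pi * \<i> * \<tau> * of_real a ^ 2) =
       (complex_of_int n * (of_int n - 1)) * (of_real pi * \<i> * \<tau> * of_real a ^ 2)"
      unfolding k' by simp
    then show ?thesis by (simp add: algebra_simps power2_eq_square)
  qed
  ultimately show ?thesis unfolding gterm_def jterm_def by (simp add: exp_add)
qed

lemma has_sum_times:
  fixes f g :: "int \<Rightarrow> complex"
  assumes f: "(f has_sum a) UNIV" "(\<lambda>n. norm (f n)) summable_on UNIV"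
    and g: "(g has_sum b) UNIV" "(\<lambda>n. norm (g n)) summable_on UNIV"
  shows "((\<lambda>(k, l). f k * g l) has_sum (a * b)) (UNIV \<times> UNIV)"
proof -
  have "(\<lambda>p. norm ((\<lambda>(k, l). f k * g l) p)) summable_on (UNIV \<times> UNIV)"
  proof (rule Infinite_Sum.abs_summable_on_Sigma_iff[THEN iffD2], intro conjI ballI)
    show "(\<lambda>l. norm ((\<lambda>(k, l). f k * g l) (k, l))) summable_on UNIV" for k
      using g(2) by (simp add: norm_mult summable_on_cmult_right)
    show "(\<lambda>k. norm (\<Sum>\<^sub>\<infinity>l. norm ((\<lambda>(k, l). f k * g l) (k, l)))) summable_on UNIV"
      using f(2) g(2) by (simp add: norm_mult infsum_cmult_right summable_on_cmult_left abs_mult infsum_nonneg)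
  qed
  then have "(\<lambda>(k, l). f k * g l) summable_on (UNIV \<times> UNIV)"
    using abs_summable_summable by blast
  then obtain S where S: "((\<lambda>(k, l). f k * g l) has_sum S) (UNIV \<times> UNIV)"
    unfolding summable_on_def by blast
  have "((\<lambda>k. f k * b) has_sum S) UNIV"
    by (rule has_sum_SigmaD[OF S]) (use has_sum_cmult_right[OF g(1)] in auto)
  then have "S = a * b"
    by (rule has_sum_unique) (rule has_sum_cmult_left[OF f(1)])
  with S show ?thesis by simp
qed

section \<open>The Wronskian of the two theta series\<close>

lemma norm_qvar: "norm (qvar \<tau>) = exp (- (2 * pi * Im \<tau>))"
  unfolding qvar_def norm_exp_eq_Re by simp

lemma nome_qvar: "Im \<tau> > 0 \<Longrightarrow> nome (qvar \<tau>)"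
  by (unfold_locales) (auto simp: norm_qvar, simp add: qvar_def)

lemma qvar_mult: "qvar (of_nat k * \<tau>) = qvar \<tau> ^ k"
  by (simp add: qvar_def mult_ac flip: exp_of_nat_mult)

text \<open>The weight n - 1/2 splits into n, which gives Jacobi's cube, and a constant, whose
  series vanishes because the triple product has the factor 1 - z at z = 1. The value is
  -eta(tau)^3.\<close>

lemma gsum_cube:
  assumes "Im \<tau> > 0"
  shows "gsum 1 (- 1 / 2) 1 \<tau> = - (exp (of_real pi * \<i> * \<tau> / 4) * qpoch_inf (qvar \<tau>) 1 ^ 3)"
proof -
  interpret nome "qvar \<tau>" using assms by (rule nome_qvar)
  let ?q = "qvar \<tau>"
  have "qprod 1 ?q = 0"
    using has_prod_eq_0_iff[OF qprod_has_prod[of 1]] by (auto intro!: rev_image_eqI[of 0])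
  then have 0: "(jterm ?q 1 has_sum 0) UNIV"
    using jacobi_triple_product[of 1] by simp
  have "gterm 1 (- 1 / 2) 0 \<tau> n = exp (of_real pi * \<i> * \<tau> / 4) * jterm ?q 1 n" for n
    using gterm_eq_jterm[of 1 "-1/2" \<tau> n] by (simp add: qvar_def power2_eq_square)
  moreover have "gterm 1 (- 1 / 2) 1 \<tau> n = (of_int n - 1 / 2) * gterm 1 (- 1 / 2) 0 \<tau> n" for n
    by (simp add: gterm_def)
  ultimately have "gterm 1 (- 1 / 2) 1 \<tau> =
      (\<lambda>n. exp (of_real pi * \<i> * \<tau> / 4) * (of_int n * jterm ?q 1 n + (- 1 / 2) * jterm ?q 1 n))"
    by (auto simp: algebra_simps)
  moreover have "((\<lambda>n. exp (of_real pi * \<i> * \<tau> / 4) * (of_int n * jterm ?q 1 n + (- 1 / 2) * jterm ?q 1 n)) has_sum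
      (exp (of_real pi * \<i> * \<tau> / 4) * (- (qpoch_inf ?q 1 ^ 3) + (- 1 / 2) * 0))) UNIV"
    by (intro has_sum_cmult_right has_sum_add jacobi_cube 0)
  ultimately show ?thesis
    unfolding gsum_def using infsumI by fastforce
qed

text \<open>With \<open>K = k - 1/2\<close>, \<open>L = l - 1/2\<close>, \<open>A = 2 K + L\<close>, \<open>B = K - 2 L\<close> one has \<open>A\<^sup>2 + B\<^sup>2 = 5 (K\<^sup>2 + L\<^sup>2)\<close> (multiplication by
  \<open>2 - \<i>\<close> on the Gaussian integers); sorting the pairs \<open>(k, l)\<close> by the residue \<open>j\<close> of \<open>A - 1/2\<close> modulo \<open>5\<close>
  makes the sum over each class a product of two one-dimensional sums.\<close>

lemma gterm_norm_form:
  fixes n s j :: int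
  defines "k \<equiv> s + 2 * n + 1" and "l \<equiv> n - 2 * s + j"
  shows "3 * (gterm 1 (- 1 / 2) 2 (5 * \<tau>) k * gterm 1 (- 1 / 2) 0 (5 * \<tau>) l)
       + 8 * (gterm 1 (- 1 / 2) 1 (5 * \<tau>) k * gterm 1 (- 1 / 2) 1 (5 * \<tau>) l)
       - 3 * (gterm 1 (- 1 / 2) 0 (5 * \<tau>) k * gterm 1 (- 1 / 2) 2 (5 * \<tau>) l) =
     (- 1) powi (j + 1) *
       (gterm 5 (of_int j + 1 / 2) 2 \<tau> n * gterm 5 (3 / 2 - 2 * of_int j) 0 \<tau> s
      - gterm 5 (of_int j + 1 / 2) 0 \<tau> n * gterm 5 (3 / 2 - 2 * of_int j) 2 \<tau> s)"
proof -
  define K L A B :: complex where "K = of_real (1 * of_int k + - 1 / 2)" and "L = of_real (1 * of_int l + - 1 / 2)"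
    and "A = of_real (5 * of_int n + (of_int j + 1 / 2))" and "B = of_real (5 * of_int s + (3 / 2 - 2 * of_int j))"
  have AB: "A = 2 * K + L" "B = K - 2 * L"
    by (simp_all add: K_def L_def A_def B_def k_def l_def)
  define w where "w = of_real pi * \<i> * \<tau>"
  have f1: "exp (w * A\<^sup>2) * exp (w * B\<^sup>2) = exp (5 * w * K\<^sup>2) * exp (5 * w * L\<^sup>2)"
    unfolding AB by (simp add: algebra_simps power2_eq_square flip: exp_add)
  have f2: "of_real pi * \<i> * (5 * \<tau>) = 5 * w" by (simp add: w_def)
  have f3: "(- 1 :: complex) powi k * (- 1) powi l = (- 1) powi (j + 1) * ((- 1) powi n * (- 1) powi s)"
  proof -
    have e: "k + l = (j + 1) + (n + s) + 2 * (n - s)" by (simp add: k_def l_def)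
    have "(- 1 :: complex) powi k * (- 1) powi l = (- 1) powi (k + l)" by (simp add: power_int_add)
    also have "\<dots> = (- 1) powi (j + 1) * ((- 1) powi n * (- 1) powi s) * (- 1) powi (2 * (n - s))"
      unfolding e by (subst power_int_add, simp)+ (simp only: mult.assoc)
    also have "(- 1 :: complex) powi (2 * (n - s)) = 1" by (simp add: power_int_mult)
    finally show ?thesis by simp
  qed
  \<comment> \<open>The weight A^2 - B^2 turns each class into a Wronskian-type difference; in K and
    L only its mixed term 8 K L will survive the summation.\<close>
  have f4: "3 * K\<^sup>2 + 8 * (K * L) - 3 * L\<^sup>2 = A\<^sup>2 - B\<^sup>2"
    unfolding AB by (simp add: algebra_simps power2_eq_square)
  have f5: "3 * (gterm 1 (- 1 / 2) 2 (5 * \<tau>) k * gterm 1 (- 1 / 2) 0 (5 * \<tau>) l)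
       + 8 * (gterm 1 (- 1 / 2) 1 (5 * \<tau>) k * gterm 1 (- 1 / 2) 1 (5 * \<tau>) l)
       - 3 * (gterm 1 (- 1 / 2) 0 (5 * \<tau>) k * gterm 1 (- 1 / 2) 2 (5 * \<tau>) l)
     = ((- 1) powi k * (- 1) powi l) * (3 * K\<^sup>2 + 8 * (K * L) - 3 * L\<^sup>2) *
       (exp (of_real pi * \<i> * (5 * \<tau>) * K\<^sup>2) * exp (of_real pi * \<i> * (5 * \<tau>) * L\<^sup>2))"
    unfolding gterm_def K_def[symmetric] L_def[symmetric] by (simp add: algebra_simps)
  have f6: "gterm 5 (of_int j + 1 / 2) 2 \<tau> n * gterm 5 (3 / 2 - 2 * of_int j) 0 \<tau> s
      - gterm 5 (of_int j + 1 / 2) 0 \<tau> n * gterm 5 (3 / 2 - 2 * of_int j) 2 \<tau> s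
     = ((- 1) powi n * (- 1) powi s) * (A\<^sup>2 - B\<^sup>2) * (exp (w * A\<^sup>2) * exp (w * B\<^sup>2))"
    unfolding gterm_def A_def[symmetric] B_def[symmetric] w_def by (simp add: algebra_simps)
  show ?thesis unfolding f5 f6 f1 f2 f3 f4 by (simp only: mult.assoc)
qed

text \<open>The sum over all pairs is evaluated twice: as 8 eta(5 tau)^6 through
  \<open>gsum_cube\<close>, and by residue classes, four of which equal the left side while one
  vanishes. By \<open>gsum_deriv\<close> the left side is A B' - A' B divided by pi i.\<close>

theorem theta_wronskian:
  assumes t: "Im \<tau> > 0"
  shows "gsum 5 (1 / 2) 0 \<tau> * gsum 5 (3 / 2) 2 \<tau> - gsum 5 (3 / 2) 0 \<tau> * gsum 5 (1 / 2) 2 \<tau> =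
    2 * exp (of_real pi * \<i> * \<tau> * (5 / 2)) * qpoch_inf (qvar \<tau> ^ 5) 1 ^ 6"
proof -
  define h where "h = (\<lambda>m. gterm 1 (- 1 / 2) m (5 * \<tau>))"
  define H where "H = (\<lambda>m. gsum 1 (- 1 / 2) m (5 * \<tau>))"
  define T where "T = (\<lambda>r. gsum 5 r 0 \<tau>)"
  define V where "V = (\<lambda>r. gsum 5 r 2 \<tau>)"
  have t5: "Im (5 * \<tau>) > 0" using t by simp
  have hh: "((\<lambda>(k, l). h m k * h m' l) has_sum (H m * H m')) (UNIV \<times> UNIV)"
    if "m \<le> 2" "m' \<le> 2" for m m'
    unfolding h_def H_def using that t5
    by (intro has_sum_times gsum_has_sum gterm_abs_summable) auto
  \<comment> \<open>the terms with \<open>K\<^sup>2\<close> and \<open>L\<^sup>2\<close> cancel in the total by the symmetry between \<open>k\<close> and \<open>l\<close>\<close>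
  define F where "F = (\<lambda>(k, l). 3 * (h 2 k * h 0 l) + 8 * (h 1 k * h 1 l) - 3 * (h 0 k * h 2 l))"
  have "((\<lambda>p. 3 * (\<lambda>(k, l). h 2 k * h 0 l) p + 8 * (\<lambda>(k, l). h 1 k * h 1 l) p
        + (- 3) * (\<lambda>(k, l). h 0 k * h 2 l) p) has_sum
      (3 * (H 2 * H 0) + 8 * (H 1 * H 1) + (- 3) * (H 0 * H 2))) (UNIV \<times> UNIV)"
    by (intro has_sum_add has_sum_cmult_right hh) auto
  then have F: "(F has_sum (8 * H 1 ^ 2)) (UNIV \<times> UNIV)"
    by (simp add: F_def case_prod_unfold power2_eq_square mult_ac)
  have R: "((\<lambda>(j, n, s). F (s + 2 * n + 1, n - 2 * s + j)) has_sum (8 * H 1 ^ 2)) ({0..<5} \<times> (UNIV \<times> UNIV))"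
  \<comment> \<open>Since 2 k + l - 2 = 5 n + j, division by 5 recovers j and n, and then s = k - 2
    n - 1.\<close>
  proof (rule iffD2[OF has_sum_reindex_bij_witness F])
    show "(\<lambda>(k, l). ((2 * k + l - 2) mod 5, (2 * k + l - 2) div 5, k - 2 * ((2 * k + l - 2) div 5) - 1))
        ((\<lambda>(j, n, s). (s + 2 * n + 1, n - 2 * s + j)) a) = a" if "a \<in> {0..<5} \<times> (UNIV \<times> UNIV)" for a :: "int \<times> int \<times> int"
    proof -
      obtain j n s where a: "a = (j, n, s)" by (metis prod_cases3)
      have "2 * (s + 2 * n + 1) + (n - 2 * s + j) - 2 = j + 5 * n" by simp
      then show ?thesis using that by (simp add: a)
    qed
    show "(\<lambda>(j, n, s). (s + 2 * n + 1, n - 2 * s + j))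
       ((\<lambda>(k, l). ((2 * k + l - 2) mod 5, (2 * k + l - 2) div 5, k - 2 * ((2 * k + l - 2) div 5) - 1)) b) = b" for b :: "int \<times> int"
    proof -
      obtain k l where b: "b = (k, l)" by (metis surj_pair)
      show ?thesis
        using mult_div_mod_eq[of 5 "2 * k + l - 2"] by (simp add: b)
    qed
  qed auto
  define C where "C = (\<lambda>j::int. (- 1) powi (j + 1) *
       (V (of_int j + 1 / 2) * T (3 / 2 - 2 * of_int j) - T (of_int j + 1 / 2) * V (3 / 2 - 2 * of_int j)))"
  have "(C has_sum (8 * H 1 ^ 2)) {0..<5}"
  proof (rule has_sum_SigmaD[OF R])
    fix j :: int
    have "((\<lambda>p. (- 1) powi (j + 1) *
       ((\<lambda>(n, s). gterm 5 (of_int j + 1 / 2) 2 \<tau> n * gterm 5 (3 / 2 - 2 * of_int j) 0 \<tau> s) p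
      + - ((\<lambda>(n, s). gterm 5 (of_int j + 1 / 2) 0 \<tau> n * gterm 5 (3 / 2 - 2 * of_int j) 2 \<tau> s) p)))
      has_sum ((- 1) powi (j + 1) *
       (V (of_int j + 1 / 2) * T (3 / 2 - 2 * of_int j) + - (T (of_int j + 1 / 2) * V (3 / 2 - 2 * of_int j))))) (UNIV \<times> UNIV)"
      unfolding T_def V_def using t
      by (intro has_sum_cmult_right has_sum_add has_sum_uminusI has_sum_times gsum_has_sum gterm_abs_summable) auto
    moreover have "(\<lambda>(j, n, s). F (s + 2 * n + 1, n - 2 * s + j)) (j, p) = (- 1) powi (j + 1) *
       ((\<lambda>(n, s). gterm 5 (of_int j + 1 / 2) 2 \<tau> n * gterm 5 (3 / 2 - 2 * of_int j) 0 \<tau> s) p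
      + - ((\<lambda>(n, s). gterm 5 (of_int j + 1 / 2) 0 \<tau> n * gterm 5 (3 / 2 - 2 * of_int j) 2 \<tau> s) p))" for p
      using gterm_norm_form[of \<tau> "snd p" "fst p" j] by (simp add: F_def h_def case_prod_unfold)
    ultimately show "((\<lambda>p. (\<lambda>(j, n, s). F (s + 2 * n + 1, n - 2 * s + j)) (j, p)) has_sum C j) (UNIV \<times> UNIV)"
      by (simp add: C_def)
  qed
  then have "sum C {0..<5} = 8 * H 1 ^ 2"
    by (simp add: has_sum_finite_iff)
  also have "{0..<5} = {0, 1, 2, 3, 4 :: int}" by auto
  finally have S: "C 0 + C 1 + C 2 + C 3 + C 4 = 8 * H 1 ^ 2" by (simp add: add_ac)
  have um: "T (- r) = T r" "V (- r) = V r" for r by (simp_all add: T_def V_def gsum_uminus)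
  have sh: "T (r + 5) = - T r" "V (r + 5) = - V r" for r by (simp_all add: T_def V_def gsum_shift)
  have T: "T (- (1 / 2)) = T (1 / 2)" "T (- (5 / 2)) = T (5 / 2)" "T (7 / 2) = - T (3 / 2)"
     "T (- (9 / 2)) = - T (1 / 2)" "T (9 / 2) = - T (1 / 2)" "T (- (13 / 2)) = - T (3 / 2)"
    using um(1)[of "1/2"] um(1)[of "5/2"] um(1)[of "9/2"] um(1)[of "13/2"] um(1)[of "3/2"]
      sh(1)[of "- (3 / 2)"] sh(1)[of "- (1 / 2)"] sh(1)[of "3 / 2"] by simp_all
  have V: "V (- (1 / 2)) = V (1 / 2)" "V (- (5 / 2)) = V (5 / 2)" "V (7 / 2) = - V (3 / 2)"
     "V (- (9 / 2)) = - V (1 / 2)" "V (9 / 2) = - V (1 / 2)" "V (- (13 / 2)) = - V (3 / 2)"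
    using um(2)[of "1/2"] um(2)[of "5/2"] um(2)[of "9/2"] um(2)[of "13/2"] um(2)[of "3/2"]
      sh(2)[of "- (3 / 2)"] sh(2)[of "- (1 / 2)"] sh(2)[of "3 / 2"] by simp_all
  \<comment> \<open>The class j = 2 pairs the offsets 5/2 and -5/2 and contributes 0; each of the
    other four contributes the same Wronskian.\<close>
  have "C 0 + C 1 + C 2 + C 3 + C 4 = 4 * (T (1 / 2) * V (3 / 2) - T (3 / 2) * V (1 / 2))"
    unfolding C_def by (simp add: T V algebra_simps)
  then have "4 * (T (1 / 2) * V (3 / 2) - T (3 / 2) * V (1 / 2)) = 4 * (2 * H 1 ^ 2)"
    unfolding S by simp
  then have "T (1 / 2) * V (3 / 2) - T (3 / 2) * V (1 / 2) = 2 * H 1 ^ 2"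
    by (subst (asm) mult_left_cancel) simp_all
  also have "H 1 = - (exp (of_real pi * \<i> * (5 * \<tau>) / 4) * qpoch_inf (qvar (5 * \<tau>)) 1 ^ 3)"
    unfolding H_def by (rule gsum_cube[OF t5])
  also have "qvar (5 * \<tau>) = qvar \<tau> ^ 5" using qvar_mult[of 5 \<tau>] by simp
  also have "2 * (- (exp (of_real pi * \<i> * (5 * \<tau>) / 4) * qpoch_inf (qvar \<tau> ^ 5) 1 ^ 3))\<^sup>2 =
     2 * exp (of_real pi * \<i> * (5 * \<tau>) / 4) ^ 2 * qpoch_inf (qvar \<tau> ^ 5) 1 ^ 6"
    by (simp add: power_mult_distrib)
  also have "exp (of_real pi * \<i> * (5 * \<tau>) / 4) ^ 2 = exp (of_real pi * \<i> * \<tau> * (5 / 2))"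
    by (simp add: mult_ac flip: exp_of_nat_mult)
  finally show ?thesis by (simp add: T_def V_def)
qed

section \<open>Infinite products at fifth roots of unity\<close>

text \<open>The hypothesis makes w a primitive fifth root of unity, in the polynomial form that
  \<open>algebra\<close> can use.\<close>

lemma prod_fifth_roots_hom:
  fixes w x y :: complex
  assumes "1 + w + w ^ 2 + w ^ 3 + w ^ 4 = 0"
  shows "(x - y) * (x - w * y) * (x - w ^ 2 * y) * (x - w ^ 3 * y) * (x - w ^ 4 * y) = x ^ 5 - y ^ 5"
  using assms by algebra

lemma prod_fifth_roots:
  fixes w y :: complex
  assumes "1 + w + w ^ 2 + w ^ 3 + w ^ 4 = 0"
  shows "(1 - y) * (1 - w * y) * (1 - w ^ 2 * y) * (1 - w ^ 3 * y) * (1 - w ^ 4 * y) = 1 - y ^ 5"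
  using prod_fifth_roots_hom[OF assms, of 1 y] by simp

lemma fifth_root_pow5:
  fixes w :: complex
  assumes "1 + w + w ^ 2 + w ^ 3 + w ^ 4 = 0"
  shows "w ^ 5 = 1"
  using assms by algebra

lemma (in nome) nome_power: "k > 0 \<Longrightarrow> nome (q ^ k)"
  using q0 q1 by unfold_locales (simp_all add: norm_power power_less_one_iff)

lemma (in nome) nome_mult: "norm w = 1 \<Longrightarrow> nome (w * q)"
  using q0 q1 by unfold_locales (auto simp: norm_mult)

lemma (in nome) qprod_Suc: "qprod a q = (1 - a) * qprod (a * q) q"
proof -
  have "(\<Prod>k<Suc n. 1 - a * q ^ k) = (1 - a) * (\<Prod>k<n. 1 - (a * q) * q ^ k)" for n
    by (subst prod.lessThan_Suc_shift) (simp add: mult_ac)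
  moreover have "(\<lambda>n. \<Prod>k<Suc n. 1 - a * q ^ k) \<longlonglongrightarrow> qprod a q"
    by (rule LIMSEQ_Suc[OF qprod_lim])
  moreover have "(\<lambda>n. (1 - a) * (\<Prod>k<n. 1 - (a * q) * q ^ k)) \<longlonglongrightarrow> (1 - a) * qprod (a * q) q"
    by (intro tendsto_intros qprod_lim)
  ultimately show ?thesis using LIMSEQ_unique by force
qed

lemma filterlim_times5: "filterlim (\<lambda>n::nat. 5 * n) sequentially sequentially"
  by (rule filterlim_subseq) (simp add: strict_mono_def)

lemma qfin_add5: "qfin x (5 * Suc n) = qfin x (5 * n) * (1 - x ^ (5 * n + 1)) * (1 - x ^ (5 * n + 2))
    * (1 - x ^ (5 * n + 3)) * (1 - x ^ (5 * n + 4)) * (1 - x ^ (5 * n + 5))"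
proof -
  have S: "qfin x m' = qfin x m * (1 - x ^ m')" if "m' = Suc m" for m m'
    unfolding that qfin_def by (rule prod.lessThan_Suc)
  show ?thesis
    using S[of "5 * n + 1" "5 * n"] S[of "5 * n + 2" "5 * n + 1"] S[of "5 * n + 3" "5 * n + 2"]
      S[of "5 * n + 4" "5 * n + 3"] S[of "5 * n + 5" "5 * n + 4"] by (simp add: add.commute)
qed

text \<open>The exponents are sorted by residue modulo 5, in blocks of five consecutive
  factors.\<close>

lemma (in nome) qpoch_split5:
  "qpoch_inf q 1 = qprod q (q ^ 5) * qprod (q ^ 2) (q ^ 5) * qprod (q ^ 3) (q ^ 5) * qprod (q ^ 4) (q ^ 5)
     * qpoch_inf (q ^ 5) 1"
proof -
  interpret p: nome "q ^ 5" by (rule nome_power) simp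
  let ?P = "\<lambda>i n. \<Prod>k<n. 1 - q ^ i * (q ^ 5) ^ k"
  have "qfin q (5 * n) = ?P 1 n * ?P 2 n * ?P 3 n * ?P 4 n * qfin (q ^ 5) n" for n
  proof (induction n)
    case 0
    show ?case by (simp add: qfin_def)
  next
    case (Suc n)
    have e: "q ^ (5 * n + i) = q ^ i * (q ^ 5) ^ n" for i by (simp add: power_add mult.commute flip: power_mult)
    have f: "qfin (q ^ 5) (Suc n) = qfin (q ^ 5) n * (1 - q ^ 5 * (q ^ 5) ^ n)" by (simp add: qfin_def)
    show ?case unfolding qfin_add5 Suc e f prod.lessThan_Suc by (simp only: mult_ac)
  qed
  then have "(\<lambda>n. qfin q (5 * n)) = (\<lambda>n. ?P 1 n * ?P 2 n * ?P 3 n * ?P 4 n * qfin (q ^ 5) n)" by blast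
  moreover have "(\<lambda>n. ?P 1 n * ?P 2 n * ?P 3 n * ?P 4 n * qfin (q ^ 5) n) \<longlonglongrightarrow>
      qprod (q ^ 1) (q ^ 5) * qprod (q ^ 2) (q ^ 5) * qprod (q ^ 3) (q ^ 5) * qprod (q ^ 4) (q ^ 5)
     * qpoch_inf (q ^ 5) 1"
    by (intro tendsto_mult p.qprod_lim p.qfin_lim)
  moreover have "(\<lambda>n. qfin q (5 * n)) \<longlonglongrightarrow> qpoch_inf q 1"
    by (rule filterlim_compose[OF qfin_lim filterlim_times5])
  ultimately show ?thesis using LIMSEQ_unique by force
qed

text \<open>Here the roots multiply the argument and not the nome, so the five factors with exponent
  m always collapse to 1 - q^(5 m).\<close>

lemma (in nome) qpoch_roots_base:
  assumes w: "1 + w + w ^ 2 + w ^ 3 + w ^ 4 = 0"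
  shows "qpoch_inf q 1 * qprod (w * q) q * qprod (w ^ 2 * q) q * qprod (w ^ 3 * q) q * qprod (w ^ 4 * q) q
    = qpoch_inf (q ^ 5) 1"
proof -
  interpret p: nome "q ^ 5" by (rule nome_power) simp
  let ?P = "\<lambda>i n. \<Prod>k<n. 1 - (w ^ i * q) * q ^ k"
  have "qfin q n * ?P 1 n * ?P 2 n * ?P 3 n * ?P 4 n = qfin (q ^ 5) n" for n
  proof (induction n)
    case 0
    show ?case by (simp add: qfin_def)
  next
    case (Suc n)
    have "qfin q (Suc n) * ?P 1 (Suc n) * ?P 2 (Suc n) * ?P 3 (Suc n) * ?P 4 (Suc n) =
       (qfin q n * ?P 1 n * ?P 2 n * ?P 3 n * ?P 4 n) * ((1 - q ^ Suc n) * (1 - w * q ^ Suc n)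
        * (1 - w ^ 2 * q ^ Suc n) * (1 - w ^ 3 * q ^ Suc n) * (1 - w ^ 4 * q ^ Suc n))"
      by (simp add: qfin_def mult_ac)
    also have "\<dots> = qfin (q ^ 5) n * (1 - (q ^ Suc n) ^ 5)"
      unfolding Suc prod_fifth_roots[OF w] ..
    also have "(q ^ Suc n) ^ 5 = (q ^ 5) ^ Suc n"
      by (simp only: mult.commute flip: power_mult)
    also have "qfin (q ^ 5) n * (1 - (q ^ 5) ^ Suc n) = qfin (q ^ 5) (Suc n)"
      by (simp add: qfin_def)
    finally show ?case .
  qed
  then have "(\<lambda>n. qfin q n * ?P 1 n * ?P 2 n * ?P 3 n * ?P 4 n) = qfin (q ^ 5)" by blast
  moreover have "(\<lambda>n. qfin q n * ?P 1 n * ?P 2 n * ?P 3 n * ?P 4 n) \<longlonglongrightarrow>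
      qpoch_inf q 1 * qprod (w ^ 1 * q) q * qprod (w ^ 2 * q) q * qprod (w ^ 3 * q) q * qprod (w ^ 4 * q) q"
    by (intro tendsto_mult qprod_lim qfin_lim)
  ultimately show ?thesis using LIMSEQ_unique p.qfin_lim by force
qed

text \<open>Now the roots multiply the nome, and a factor becomes 1 - w^(i m) q^m. If 5 does not
  divide m, the five factors multiply to 1 - q^(5 m); if 5 divides m, they coincide and give (1 -
  q^m)^5. The product in q^25 supplies the exponents missing from the first kind.\<close>

lemma (in nome) qpoch_roots_nome:
  assumes w: "1 + w + w ^ 2 + w ^ 3 + w ^ 4 = 0"
  shows "qpoch_inf q 1 * qpoch_inf (w * q) 1 * qpoch_inf (w ^ 2 * q) 1 * qpoch_inf (w ^ 3 * q) 1 * qpoch_inf (w ^ 4 * q) 1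
    * qpoch_inf (q ^ 25) 1 = qpoch_inf (q ^ 5) 1 ^ 6"
proof -
  note w5 = fifth_root_pow5[OF w]
  have nw: "norm w = 1"
    using arg_cong[OF w5, of norm] power_eq_iff_eq_base[of 5 "norm w" 1] by (simp add: norm_power)
  interpret p: nome "q ^ 5" by (rule nome_power) simp
  interpret p25: nome "q ^ 25" by (rule nome_power) simp
  have nm: "nome (w ^ i * q)" for i by (rule nome_mult) (simp add: norm_power nw)
  let ?F = "\<lambda>n. qfin q (5 * n) * qfin (w ^ 1 * q) (5 * n) * qfin (w ^ 2 * q) (5 * n) * qfin (w ^ 3 * q) (5 * n)
     * qfin (w ^ 4 * q) (5 * n) * qfin (q ^ 25) n"
  have "?F n = qfin (q ^ 5) (5 * n) * qfin (q ^ 5) n ^ 5" for n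
  proof (induction n)
    case 0
    show ?case by (simp add: qfin_def)
  next
    case (Suc n)
    define y where "y = (\<lambda>j. q ^ (5 * n + j))"
    have e0: "q ^ (5 * n + j) = y j" for j by (simp add: y_def)
    have e: "(w ^ i * q) ^ (5 * n + j) = w ^ (i * j) * y j" for i j
    proof -
      have "w ^ (i * (5 * n + j)) = (w ^ 5) ^ (i * n) * w ^ (i * j)"
        by (simp add: distrib_left power_add mult_ac flip: power_mult)
      then show ?thesis by (simp add: power_mult_distrib w5 y_def flip: power_mult)
    qed
    have red: "w ^ 6 = w" "w ^ 8 = w ^ 3" "w ^ 9 = w ^ 4" "w ^ 12 = w ^ 2" "w ^ 16 = w"
      "w ^ 10 = 1" "w ^ 15 = 1" "w ^ 20 = 1"
    proof -
      have r: "w ^ (5 * a + b) = w ^ b" for a b by (simp add: power_add power_mult w5)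
      show "w ^ 6 = w" "w ^ 8 = w ^ 3" "w ^ 9 = w ^ 4" "w ^ 12 = w ^ 2" "w ^ 16 = w" "w ^ 10 = 1" "w ^ 15 = 1" "w ^ 20 = 1"
        using r[of 1 1] r[of 1 3] r[of 1 4] r[of 2 2] r[of 3 1] r[of 2 0] r[of 3 0] r[of 4 0] by simp_all
    qed
    have "(q ^ 25) ^ Suc n = y 5 ^ 5" "(q ^ 5) ^ Suc n = y 5"
      by (simp_all add: y_def algebra_simps flip: power_mult power_Suc)
    then have 5: "qfin (q ^ 25) (Suc n) = qfin (q ^ 25) n * (1 - y 5 ^ 5)"
      and 6: "qfin (q ^ 5) (Suc n) = qfin (q ^ 5) n * (1 - y 5)"
      by (simp_all only: qfin_def prod.lessThan_Suc)
    have 7: "(q ^ 5) ^ (5 * n + j) = y j ^ 5" for j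
      by (simp add: y_def mult.commute flip: power_mult)
    have 8: "z ^ 5 = z * z * z * z * z" for z :: complex
      by (simp add: eval_nat_numeral mult.assoc)
    have G0: "qfin q (5 * Suc n) = qfin q (5 * n) * (1 - y 1) * (1 - y 2) * (1 - y 3) * (1 - y 4) * (1 - y 5)"
      unfolding qfin_add5 e0 ..
    have G1: "qfin (w ^ 1 * q) (5 * Suc n) = qfin (w ^ 1 * q) (5 * n) * (1 - w * y 1) * (1 - w ^ 2 * y 2) * (1 - w ^ 3 * y 3) * (1 - w ^ 4 * y 4) * (1 - y 5)"
      unfolding qfin_add5 e by (simp add: red w5)
    have G2: "qfin (w ^ 2 * q) (5 * Suc n) = qfin (w ^ 2 * q) (5 * n) * (1 - w ^ 2 * y 1) * (1 - w ^ 4 * y 2) * (1 - w * y 3) * (1 - w ^ 3 * y 4) * (1 - y 5)"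
      unfolding qfin_add5 e by (simp add: red w5)
    have G3: "qfin (w ^ 3 * q) (5 * Suc n) = qfin (w ^ 3 * q) (5 * n) * (1 - w ^ 3 * y 1) * (1 - w * y 2) * (1 - w ^ 4 * y 3) * (1 - w ^ 2 * y 4) * (1 - y 5)"
      unfolding qfin_add5 e by (simp add: red w5)
    have G4: "qfin (w ^ 4 * q) (5 * Suc n) = qfin (w ^ 4 * q) (5 * n) * (1 - w ^ 4 * y 1) * (1 - w ^ 3 * y 2) * (1 - w ^ 2 * y 3) * (1 - w * y 4) * (1 - y 5)"
      unfolding qfin_add5 e by (simp add: red w5)
    have "?F (Suc n) = ?F n * 
       ((1 - y 1) * (1 - w * y 1) * (1 - w ^ 2 * y 1) * (1 - w ^ 3 * y 1) * (1 - w ^ 4 * y 1)) * 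
       ((1 - y 2) * (1 - w * y 2) * (1 - w ^ 2 * y 2) * (1 - w ^ 3 * y 2) * (1 - w ^ 4 * y 2)) * 
       ((1 - y 3) * (1 - w * y 3) * (1 - w ^ 2 * y 3) * (1 - w ^ 3 * y 3) * (1 - w ^ 4 * y 3)) * 
       ((1 - y 4) * (1 - w * y 4) * (1 - w ^ 2 * y 4) * (1 - w ^ 3 * y 4) * (1 - w ^ 4 * y 4))
       * ((1 - y 5) ^ 5 * (1 - y 5 ^ 5))"
      unfolding G0 G1 G2 G3 G4 5 8[of "1 - y 5"] by (simp only: mult_ac)
    also have "\<dots> = qfin (q ^ 5) (5 * Suc n) * qfin (q ^ 5) (Suc n) ^ 5"
      unfolding prod_fifth_roots[OF w] Suc qfin_add5 6 7 power_mult_distrib by (simp only: mult_ac)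
    finally show ?case .
  qed
  then have F: "?F = (\<lambda>n. qfin (q ^ 5) (5 * n) * qfin (q ^ 5) n ^ 5)" by blast
  have L: "?F \<longlonglongrightarrow> qpoch_inf q 1 * qpoch_inf (w ^ 1 * q) 1 * qpoch_inf (w ^ 2 * q) 1
      * qpoch_inf (w ^ 3 * q) 1 * qpoch_inf (w ^ 4 * q) 1 * qpoch_inf (q ^ 25) 1"
    by (intro tendsto_mult filterlim_compose[OF nome.qfin_lim filterlim_times5] nm nome_axioms p25.qfin_lim)
  have R: "(\<lambda>n. qfin (q ^ 5) (5 * n) * qfin (q ^ 5) n ^ 5) \<longlonglongrightarrow> qpoch_inf (q ^ 5) 1 * qpoch_inf (q ^ 5) 1 ^ 5"
    by (intro tendsto_intros filterlim_compose[OF p.qfin_lim filterlim_times5] p.qfin_lim)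
  from R have "qpoch_inf q 1 * qpoch_inf (w ^ 1 * q) 1 * qpoch_inf (w ^ 2 * q) 1
      * qpoch_inf (w ^ 3 * q) 1 * qpoch_inf (w ^ 4 * q) 1 * qpoch_inf (q ^ 25) 1 = qpoch_inf (q ^ 5) 1 * qpoch_inf (q ^ 5) 1 ^ 5"
    by (rule LIMSEQ_unique[OF L[unfolded F]])
  moreover have "z * z ^ 5 = z ^ 6" for z :: complex
    by (simp add: eval_nat_numeral)
  ultimately show ?thesis by simp
qed

section \<open>The two theta series as infinite products\<close>

lemma gsum_product:
  fixes a r :: real
  assumes "a > 0" "Im \<tau> > 0"
  defines "p \<equiv> exp (2 * of_real pi * \<i> * \<tau> * of_real a ^ 2)"
    and "z \<equiv> exp (of_real pi * \<i> * \<tau> * of_real (2 * a * r + a ^ 2))"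
  shows "gsum a r 0 \<tau> = exp (of_real pi * \<i> * \<tau> * of_real r ^ 2) * (qpoch_inf p 1 * (qprod z p * qprod (p / z) p))"
proof -
  have p: "p = qvar (of_real (a ^ 2) * \<tau>)" by (simp add: p_def qvar_def mult_ac)
  have "Im (of_real (a ^ 2) * \<tau>) > 0" using assms by (simp del: of_real_power)
  then interpret nome p unfolding p by (rule nome_qvar)
  have "z \<noteq> 0" by (simp add: z_def)
  from has_sum_cmult_right[OF jacobi_triple_product[OF this], of "exp (of_real pi * \<i> * \<tau> * of_real r ^ 2)"]
  show ?thesis unfolding gsum_def gterm_eq_jterm p_def[symmetric] z_def[symmetric] by (rule infsumI)
qed

text \<open>In the nome q^25 the triple product arguments are q^15 and q^20, with partners q^10 and
  q^5: exactly the classes that complete (q^25; q^25) to (q^5; q^5). The value is eta(5 tau) eta(25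
  tau).\<close>

theorem gsum_pair_product:
  assumes t: "Im \<tau> > 0"
  shows "gsum 5 (1 / 2) 0 \<tau> * gsum 5 (3 / 2) 0 \<tau> =
    exp (of_real pi * \<i> * \<tau> * (5 / 2)) * qpoch_inf (qvar \<tau> ^ 25) 1 * qpoch_inf (qvar \<tau> ^ 5) 1"
proof -
  interpret nome "qvar \<tau>" using t by (rule nome_qvar)
  interpret p: nome "qvar \<tau> ^ 5" by (rule nome_power) simp
  let ?q = "qvar \<tau>"
  have qe: "exp (of_real pi * \<i> * \<tau> * (2 * of_nat k)) = ?q ^ k" for k
    by (simp add: qvar_def mult_ac flip: exp_of_nat_mult)
  have "exp (2 * of_real pi * \<i> * \<tau> * of_real 5 ^ 2) = ?q ^ 25"
    using qe[of 25] by (simp add: mult_ac)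
  moreover have "exp (of_real pi * \<i> * \<tau> * of_real (2 * 5 * (1 / 2) + 5 ^ 2)) = ?q ^ 15"
    using qe[of 15] by simp
  moreover have "exp (of_real pi * \<i> * \<tau> * of_real (2 * 5 * (3 / 2) + 5 ^ 2)) = ?q ^ 20"
    using qe[of 20] by simp
  moreover have "?q ^ 25 / ?q ^ 15 = ?q ^ 10" "?q ^ 25 / ?q ^ 20 = ?q ^ 5"
    using q0 by (simp_all flip: power_diff)
  ultimately have "gsum 5 (1 / 2) 0 \<tau> * gsum 5 (3 / 2) 0 \<tau> =
     (exp (of_real pi * \<i> * \<tau> * of_real (1 / 2) ^ 2) * exp (of_real pi * \<i> * \<tau> * of_real (3 / 2) ^ 2)) *
     (qpoch_inf (?q ^ 25) 1 * (qprod (?q ^ 5) (?q ^ 25) * qprod (?q ^ 10) (?q ^ 25)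
       * qprod (?q ^ 15) (?q ^ 25) * qprod (?q ^ 20) (?q ^ 25) * qpoch_inf (?q ^ 25) 1))"
    using gsum_product[of 5 \<tau> "1/2"] gsum_product[of 5 \<tau> "3/2"] t by (simp only: mult_ac)
  also have "exp (of_real pi * \<i> * \<tau> * of_real (1 / 2) ^ 2) * exp (of_real pi * \<i> * \<tau> * of_real (3 / 2) ^ 2)
     = exp (of_real pi * \<i> * \<tau> * (5 / 2))"
    by (simp add: power2_eq_square algebra_simps flip: exp_add)
  also have "qprod (?q ^ 5) (?q ^ 25) * qprod (?q ^ 10) (?q ^ 25)
       * qprod (?q ^ 15) (?q ^ 25) * qprod (?q ^ 20) (?q ^ 25) * qpoch_inf (?q ^ 25) 1 = qpoch_inf (?q ^ 5) 1"
    using p.qpoch_split5 by (simp flip: power_mult)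
  finally show ?thesis by (simp add: mult_ac)
qed

section \<open>Quintic dissection of the theta constants\<close>

text \<open>With the golden ratio f and its conjugate g each quadratic splits as (x - f z) (x - g
  z), and the products over the five roots of unity are x^5 - f^5 y^5 and x^5 - g^5 y^5. The 11 is
  the Lucas number f^5 + g^5.\<close>

lemma quadratic_norm_quintic:
  fixes w x y :: complex
  assumes w: "1 + w + w ^ 2 + w ^ 3 + w ^ 4 = 0"
  shows "(x ^ 2 - x * y - y ^ 2) * (x ^ 2 - x * (w * y) - (w * y) ^ 2) * (x ^ 2 - x * (w ^ 2 * y) - (w ^ 2 * y) ^ 2)
    * (x ^ 2 - x * (w ^ 3 * y) - (w ^ 3 * y) ^ 2) * (x ^ 2 - x * (w ^ 4 * y) - (w ^ 4 * y) ^ 2) =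
    x ^ 10 - 11 * x ^ 5 * y ^ 5 - y ^ 10"
proof -
  define s where "s = complex_of_real (sqrt 5)"
  have s2: "s ^ 2 = 5" by (simp add: s_def flip: of_real_power)
  define f where "f = (1 + s) / 2"
  define g where "g = (1 - s) / 2"
  have fg: "f + g = 1" "f * g = - 1"
    using s2 by (simp_all add: f_def g_def field_simps power2_eq_square)
  have fac: "x ^ 2 - x * z - z ^ 2 = (x - f * z) * (x - g * z)" for z
    using fg by algebra
  have "(x ^ 2 - x * y - y ^ 2) * (x ^ 2 - x * (w * y) - (w * y) ^ 2) * (x ^ 2 - x * (w ^ 2 * y) - (w ^ 2 * y) ^ 2)
    * (x ^ 2 - x * (w ^ 3 * y) - (w ^ 3 * y) ^ 2) * (x ^ 2 - x * (w ^ 4 * y) - (w ^ 4 * y) ^ 2) =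
    ((x - f * y) * (x - w * (f * y)) * (x - w ^ 2 * (f * y)) * (x - w ^ 3 * (f * y)) * (x - w ^ 4 * (f * y))) *
    ((x - g * y) * (x - w * (g * y)) * (x - w ^ 2 * (g * y)) * (x - w ^ 3 * (g * y)) * (x - w ^ 4 * (g * y)))"
    unfolding fac by (simp only: mult_ac)
  also have "\<dots> = (x ^ 5 - f ^ 5 * y ^ 5) * (x ^ 5 - g ^ 5 * y ^ 5)"
    unfolding prod_fifth_roots_hom[OF w] by (simp add: power_mult_distrib)
  also have "\<dots> = x ^ 10 - 11 * x ^ 5 * y ^ 5 - y ^ 10"
  proof -
    have "f ^ 5 + g ^ 5 = 11" "f ^ 5 * g ^ 5 = - 1" using fg by algebra+
    moreover have "(x ^ 5 - f ^ 5 * y ^ 5) * (x ^ 5 - g ^ 5 * y ^ 5) =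
        x ^ 10 - (f ^ 5 + g ^ 5) * (x ^ 5 * y ^ 5) + f ^ 5 * g ^ 5 * y ^ 10" by algebra
    ultimately show ?thesis by simp
  qed
  finally show ?thesis .
qed

lemma fifth_root_sum:
  fixes w :: complex
  assumes "w ^ 5 = 1" "w \<noteq> 1"
  shows "1 + w + w ^ 2 + w ^ 3 + w ^ 4 = 0"
proof -
  have "(w - 1) * (1 + w + w ^ 2 + w ^ 3 + w ^ 4) = w ^ 5 - 1" by algebra
  then show ?thesis using assms by simp
qed

lemma cos_pi_tenth:
  shows "2 * cos (pi / 10) * (2 * cos (3 * pi / 10)) = sqrt 5"
    and "(2 * cos (pi / 10)) ^ 2 = (5 + sqrt 5) / 2"
    and "(2 * cos (3 * pi / 10)) ^ 2 = (5 - sqrt 5) / 2"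
    and "cos (9 * pi / 10) = - cos (pi / 10)"
proof -
  define c where "c = cos (pi / 10)"
  define d where "d = cos (3 * pi / 10)"
  have c0: "c > 0" and d0: "d > 0"
    unfolding c_def d_def by (rule cos_gt_zero_pi; simp)+
  have d: "d = 4 * c ^ 3 - 3 * c"
    using cos_treble_cos[of "pi / 10"] by (simp add: c_def d_def)
  \<comment> \<open>The quartic equation for c comes from cos (pi / 2) = 0: added to c, it turns
    into a product containing d.\<close>
  have "cos (5 * pi / 10) + cos (pi / 10) = 2 * cos ((5 * pi / 10 + pi / 10) / 2) * cos ((5 * pi / 10 - pi / 10) / 2)"
    by (rule cos_plus_cos)
  moreover have "(5 * pi / 10 + pi / 10) / 2 = 3 * pi / 10" "(5 * pi / 10 - pi / 10) / 2 = 2 * (pi / 10)"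
    "5 * pi / 10 = pi / 2" by simp_all
  ultimately have "c = 2 * d * cos (2 * (pi / 10))"
    by (simp add: c_def d_def)
  then have "c = 2 * d * (2 * c ^ 2 - 1)"
    unfolding cos_double_cos c_def .
  then have "c * (16 * c ^ 4 - 20 * c ^ 2 + 5) = 0" unfolding d by algebra
  then have c4: "16 * c ^ 4 - 20 * c ^ 2 + 5 = 0" using c0 by simp
  have cd: "4 * c * d = 8 * c ^ 2 - 5" using c4 unfolding d by algebra
  have "(4 * c * d) ^ 2 = 5" unfolding cd using c4 by algebra
  then have s: "4 * c * d = sqrt 5" using c0 d0 by (intro real_sqrt_unique[symmetric]) auto
  show "2 * cos (pi / 10) * (2 * cos (3 * pi / 10)) = sqrt 5"
    using s by (simp add: c_def d_def)
  show "(2 * cos (pi / 10)) ^ 2 = (5 + sqrt 5) / 2"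
    using s cd unfolding c_def[symmetric] by (simp add: power_mult_distrib)
  have "4 * d ^ 2 = 5 - 4 * c ^ 2" using c4 unfolding d by algebra
  then show "(2 * cos (3 * pi / 10)) ^ 2 = (5 - sqrt 5) / 2"
    using s cd unfolding d_def[symmetric] by (simp add: power_mult_distrib)
  have "9 * pi / 10 = pi - pi / 10" by simp
  then show "cos (9 * pi / 10) = - cos (pi / 10)" by (simp only: cos_pi_minus)
qed

section \<open>The theta constants as products and as combinations of the two series\<close>

definition theta_term :: "real \<Rightarrow> complex \<Rightarrow> int \<Rightarrow> complex" where
  "theta_term e \<tau> n = exp (of_real pi * \<i> * \<tau> * (of_int n + 1 / 2) ^ 2 + of_real pi * \<i> * of_real e * (of_int n + 1 / 2))"

lemma theta_char_eq: "theta_char 1 e 0 \<tau> = (\<Sum>\<^sub>\<infinity>n. theta_term e \<tau> n)"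
  unfolding theta_char_def theta_term_def by (simp add: algebra_simps)

lemma exp_plus_exp_uminus: "exp (\<i> * of_real x) + exp (- (\<i> * of_real x)) = of_real (2 * cos x)"
  by (simp add: cos_of_real[symmetric] cos_exp_eq del: cos_of_real)

text \<open>Triple product at z = - q \<alpha>. The factor 1 + 1 / \<alpha>, split off from the
  second product, is symmetrised by the half power of \<alpha> in \<open>E\<close> and becomes 2 cos
  (pi e / 2).\<close>

lemma theta_term_has_sum:
  fixes e :: real
  assumes t: "Im \<tau> > 0"
  defines "\<alpha> \<equiv> exp (of_real pi * \<i> * of_real e)" and "q \<equiv> qvar \<tau>"
  shows "(theta_term e \<tau> has_sum (exp (of_real pi * \<i> * \<tau> / 4) * of_real (2 * cos (pi * e / 2)) * qpoch_inf q 1 *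
      (qprod (- \<alpha> * q) q * qprod (- 1 / \<alpha> * q) q))) UNIV"
proof -
  interpret nome q unfolding q_def using t by (rule nome_qvar)
  define E where "E = exp (of_real pi * \<i> * \<tau> / 4 + \<i> * of_real (pi * e / 2))"
  have \<alpha>: "\<alpha> \<noteq> 0" by (simp add: \<alpha>_def)
  have tt: "theta_term e \<tau> n = E * jterm q (- (q * \<alpha>)) n" for n
  proof -
    have "even (n * (n - 1))" by simp
    then obtain k where k: "n * (n - 1) = 2 * k" by (rule evenE)
    then have k': "complex_of_int n * (of_int n - 1) = 2 * of_int k"
      by (metis of_int_1 of_int_diff of_int_mult of_int_numeral)
    have "q * \<alpha> = exp (2 * of_real pi * \<i> * \<tau> + of_real pi * \<i> * of_real e)"
      by (simp add: q_def \<alpha>_def qvar_def exp_add)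
    then have "jterm q (- (q * \<alpha>)) n = exp (of_int n * (2 * of_real pi * \<i> * \<tau> + of_real pi * \<i> * of_real e))
       * exp (of_int k * (2 * of_real pi * \<i> * \<tau>))"
      unfolding jterm_def minus_minus k by (simp add: exp_power_int q_def qvar_def)
    then have "E * jterm q (- (q * \<alpha>)) n = exp (of_real pi * \<i> * \<tau> / 4 + \<i> * of_real (pi * e / 2)
       + (of_int n * (2 * of_real pi * \<i> * \<tau> + of_real pi * \<i> * of_real e) + of_int k * (2 * of_real pi * \<i> * \<tau>)))"
      unfolding E_def by (simp only: exp_add)
    also have "of_int k * (2 * of_real pi * \<i> * \<tau>) = (complex_of_int n * (of_int n - 1)) * (of_real pi * \<i> * \<tau>)"
      unfolding k' by simp
    finally show ?thesis
      unfolding theta_term_def by (simp add: algebra_simps power2_eq_square add_divide_distrib)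
  qed
  have z: "- (q * \<alpha>) \<noteq> 0" using q0 \<alpha> by simp
  have "(theta_term e \<tau> has_sum (E * (qpoch_inf q 1 * (qprod (- (q * \<alpha>)) q * qprod (q / - (q * \<alpha>)) q)))) UNIV"
    using has_sum_cmult_right[OF jacobi_triple_product[OF z], of E] by (simp add: tt[abs_def])
  also have "q / - (q * \<alpha>) = - 1 / \<alpha>" using q0 by simp
  also have "qprod (- 1 / \<alpha>) q = (1 + 1 / \<alpha>) * qprod (- 1 / \<alpha> * q) q"
    by (subst qprod_Suc) simp
  also have "E * (qpoch_inf q 1 * (qprod (- (q * \<alpha>)) q * ((1 + 1 / \<alpha>) * qprod (- 1 / \<alpha> * q) q))) =
      (E * (1 + 1 / \<alpha>)) * qpoch_inf q 1 * (qprod (- \<alpha> * q) q * qprod (- 1 / \<alpha> * q) q)"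
    by (simp add: mult_ac)
  also have "E * (1 + 1 / \<alpha>) = exp (of_real pi * \<i> * \<tau> / 4) * (exp (\<i> * of_real (pi * e / 2)) + exp (- (\<i> * of_real (pi * e / 2))))"
  proof -
    have "1 / \<alpha> = exp (- (2 * (\<i> * of_real (pi * e / 2))))"
      by (simp add: \<alpha>_def exp_minus field_simps)
    then show ?thesis by (simp add: E_def distrib_left flip: exp_add)
  qed
  finally show ?thesis unfolding exp_plus_exp_uminus .
qed

text \<open>The hypothesis on e makes the phase change sign when the index moves by 5, so each class
  modulo 5 is an alternating series. The middle class vanishes, and the classes 0, 4 and 1, 3 pair
  with opposite phases, which gives the cosines.\<close>

lemma theta_char_dissect:
  assumes t: "Im \<tau> > 0" and e: "exp (of_real pi * \<i> * of_real e * 5) = - 1"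
  shows "theta_char 1 e 0 \<tau> = of_real (2 * cos (pi * e / 2)) * gsum 5 (1 / 2) 0 \<tau>
     + of_real (2 * cos (3 * (pi * e / 2))) * gsum 5 (3 / 2) 0 \<tau>"
proof -
  define u where "u = (\<lambda>x::real. exp (of_real pi * \<i> * of_real e * of_real x))"
  have S: "(theta_term e \<tau> has_sum theta_char 1 e 0 \<tau>) UNIV"
    using infsumI[OF theta_term_has_sum[OF t]] theta_term_has_sum[OF t] by (simp add: theta_char_eq)
  have "((\<lambda>(j, m). theta_term e \<tau> (5 * m + j)) has_sum theta_char 1 e 0 \<tau>) ({0..<5} \<times> UNIV)"
    by (rule iffD2[OF has_sum_reindex_bij_witness[of _ "\<lambda>n. (n mod 5, n div 5)" "\<lambda>(j, m). 5 * m + j"] S]) auto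
  then have "((\<lambda>j. u (of_int j + 1 / 2) * gsum 5 (of_int j + 1 / 2) 0 \<tau>) has_sum theta_char 1 e 0 \<tau>) {0..<5}"
  proof (rule has_sum_SigmaD)
    fix j :: int
    have "theta_term e \<tau> (5 * m + j) = u (of_int j + 1 / 2) * gterm 5 (of_int j + 1 / 2) 0 \<tau> m" for m
    proof -
      have "of_real pi * \<i> * of_real e * (of_int (5 * m + j) + 1 / 2) =
        of_int m * (of_real pi * \<i> * of_real e * 5) + of_real pi * \<i> * of_real e * of_real (of_int j + 1 / 2)"
        by (simp add: algebra_simps)
      then have "theta_term e \<tau> (5 * m + j) = exp (of_real pi * \<i> * \<tau> * (of_int (5 * m + j) + 1 / 2) ^ 2) *
         (exp (of_real pi * \<i> * of_real e * 5) powi m * u (of_int j + 1 / 2))"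
        unfolding theta_term_def u_def exp_power_int by (simp add: exp_add)
      then show ?thesis unfolding e gterm_def by (simp add: algebra_simps)
    qed
    then show "((\<lambda>m. (\<lambda>(j, m). theta_term e \<tau> (5 * m + j)) (j, m)) has_sum
       u (of_int j + 1 / 2) * gsum 5 (of_int j + 1 / 2) 0 \<tau>) UNIV"
      using has_sum_cmult_right[OF gsum_has_sum[of 5 0 \<tau> "of_int j + 1 / 2"], of "u (of_int j + 1 / 2)"] t by simp
  qed
  then have "theta_char 1 e 0 \<tau> = (\<Sum>j\<in>{0..<5}. u (of_int j + 1 / 2) * gsum 5 (of_int j + 1 / 2) 0 \<tau>)"
    by (simp add: has_sum_finite_iff)
  also have "{0..<5} = {0, 1, 2, 3, 4 :: int}" by auto
  finally have th: "theta_char 1 e 0 \<tau> = u (1 / 2) * gsum 5 (1 / 2) 0 \<tau> + u (3 / 2) * gsum 5 (3 / 2) 0 \<tau>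
     + u (5 / 2) * gsum 5 (5 / 2) 0 \<tau> + u (7 / 2) * gsum 5 (7 / 2) 0 \<tau> + u (9 / 2) * gsum 5 (9 / 2) 0 \<tau>"
    by simp
  have g: "gsum 5 (7 / 2) 0 \<tau> = - gsum 5 (3 / 2) 0 \<tau>" "gsum 5 (9 / 2) 0 \<tau> = - gsum 5 (1 / 2) 0 \<tau>"
     "gsum 5 (5 / 2) 0 \<tau> = 0"
    using gsum_shift[of 5 "- (3 / 2)" 0 \<tau>] gsum_uminus[of 0 5 "3 / 2" \<tau>]
      gsum_shift[of 5 "- (1 / 2)" 0 \<tau>] gsum_uminus[of 0 5 "1 / 2" \<tau>]
      gsum_shift[of 5 "- (5 / 2)" 0 \<tau>] gsum_uminus[of 0 5 "5 / 2" \<tau>] by simp_all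
  have "u (5 + x) = - u x" for x
    using e unfolding u_def of_real_add distrib_left exp_add by simp
  from this[of "- (3 / 2)"] this[of "- (1 / 2)"]
  have "u (7 / 2) = - u (- (3 / 2))" "u (9 / 2) = - u (- (1 / 2))" by simp_all
  then have "theta_char 1 e 0 \<tau> = (u (1 / 2) + u (- (1 / 2))) * gsum 5 (1 / 2) 0 \<tau>
    + (u (3 / 2) + u (- (3 / 2))) * gsum 5 (3 / 2) 0 \<tau>"
    unfolding th g by (simp add: algebra_simps)
  moreover have "u x + u (- x) = of_real (2 * cos (pi * e * x))" for x
    using exp_plus_exp_uminus[of "pi * e * x"] by (simp add: u_def mult_ac)
  ultimately show ?thesis by (simp add: mult_ac)
qed

section \<open>The icosahedral form\<close>

text \<open>With w = - exp (pi i / 5) the product arguments are w q, w^4 q for one theta constant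
  and w^3 q, w^2 q for the other. Every nontrivial fifth root of unity occurs once, and
  \<open>qpoch_roots_base\<close> applies.\<close>

lemma theta_pair_product:
  assumes t: "Im \<tau> > 0"
  shows "theta_char 1 (1 / 5) 0 \<tau> * theta_char 1 (3 / 5) 0 \<tau> =
    of_real (sqrt 5) * exp (of_real pi * \<i> * \<tau> / 2) * qpoch_inf (qvar \<tau>) 1 * qpoch_inf (qvar \<tau> ^ 5) 1"
proof -
  define q where "q = qvar \<tau>"
  interpret nome q unfolding q_def using t by (rule nome_qvar)
  define a where "a = exp (of_real pi * \<i> * of_real (1 / 5))"
  define w where "w = - a"
  have "a ^ 5 = exp (\<i> * of_real pi)"
    by (simp add: a_def mult_ac flip: exp_of_nat_mult)
  then have a5: "a ^ 5 = - 1" by (simp add: exp_pi_i')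
  have a0: "a \<noteq> 0" by (simp add: a_def)
  have a3: "exp (of_real pi * \<i> * of_real (3 / 5)) = a ^ 3"
    by (simp add: a_def mult_ac flip: exp_of_nat_mult)
  have w5: "w ^ 5 = 1" using a5 by (simp add: w_def)
  have "Im a = sin (pi / 5)" by (simp add: a_def Im_exp)
  moreover have "sin (pi / 5) > 0" by (rule sin_gt_zero) simp_all
  ultimately have "Im w \<noteq> 0" by (simp add: w_def)
  then have "w \<noteq> 1" by auto
  note w = fifth_root_sum[OF w5 this]
  have ws: "- a = w" "- (a ^ 3) = w ^ 3" by (simp_all add: w_def)
  have "- 1 / a = w ^ 4 " "- 1 / (a ^ 3) = w ^ 2"
    using a5 a0 by (simp_all add: w_def field_simps flip: power_Suc power_add)
  note ws = ws this
  have th: "theta_char 1 e 0 \<tau> = exp (of_real pi * \<i> * \<tau> / 4) * of_real (2 * cos (pi * e / 2)) * qpoch_inf q 1 *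
      (qprod (- exp (of_real pi * \<i> * of_real e) * q) q * qprod (- 1 / exp (of_real pi * \<i> * of_real e) * q) q)" for e
    unfolding q_def theta_char_eq by (rule infsumI[OF theta_term_has_sum[OF t]])
  have "theta_char 1 (1 / 5) 0 \<tau> = exp (of_real pi * \<i> * \<tau> / 4) * of_real (2 * cos (pi / 10)) * qpoch_inf q 1 *
      (qprod (w * q) q * qprod (w ^ 4 * q) q)"
    using th[of "1 / 5"] unfolding a_def[symmetric] ws by (simp add: mult_ac)
  moreover have "theta_char 1 (3 / 5) 0 \<tau> = exp (of_real pi * \<i> * \<tau> / 4) * of_real (2 * cos (3 * pi / 10)) * qpoch_inf q 1 *
      (qprod (w ^ 3 * q) q * qprod (w ^ 2 * q) q)"
    using th[of "3 / 5"] unfolding a3 ws by (simp add: mult_ac)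
  ultimately have "theta_char 1 (1 / 5) 0 \<tau> * theta_char 1 (3 / 5) 0 \<tau> =
    of_real (2 * cos (pi / 10) * (2 * cos (3 * pi / 10))) *
    (exp (of_real pi * \<i> * \<tau> / 4) * exp (of_real pi * \<i> * \<tau> / 4)) * qpoch_inf q 1 *
    (qpoch_inf q 1 * qprod (w * q) q * qprod (w ^ 2 * q) q * qprod (w ^ 3 * q) q * qprod (w ^ 4 * q) q)"
    by (simp only: of_real_mult mult_ac)
  also have "exp (of_real pi * \<i> * \<tau> / 4) * exp (of_real pi * \<i> * \<tau> / 4) = exp (of_real pi * \<i> * \<tau> / 2)"
    by (simp add: mult_ac flip: exp_add)
  finally show ?thesis unfolding qpoch_roots_base[OF w] cos_pi_tenth unfolding q_def .
qed

lemma theta_chars_dissect: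
  assumes t: "Im \<tau> > 0"
  defines "c1 \<equiv> complex_of_real (2 * cos (pi / 10))" and "c3 \<equiv> complex_of_real (2 * cos (3 * pi / 10))"
  shows "theta_char 1 (1 / 5) 0 \<tau> = c1 * gsum 5 (1 / 2) 0 \<tau> + c3 * gsum 5 (3 / 2) 0 \<tau>"
    and "theta_char 1 (3 / 5) 0 \<tau> = c3 * gsum 5 (1 / 2) 0 \<tau> - c1 * gsum 5 (3 / 2) 0 \<tau>"
proof -
  have "exp (of_real pi * \<i> * of_real (1 / 5) * 5) = - 1"
    using exp_pi_i' by (simp add: mult_ac)
  from theta_char_dissect[OF t this] show "theta_char 1 (1 / 5) 0 \<tau> = c1 * gsum 5 (1 / 2) 0 \<tau> + c3 * gsum 5 (3 / 2) 0 \<tau>"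
    by (simp add: c1_def c3_def)
  have "exp (of_real pi * \<i> * of_real (3 / 5) * 5) = exp (of_nat 3 * (\<i> * of_real pi))"
    by (simp add: mult_ac)
  also have "\<dots> = - 1" unfolding exp_of_nat_mult exp_pi_i' by simp
  finally have "theta_char 1 (3 / 5) 0 \<tau> = of_real (2 * cos (pi * (3 / 5) / 2)) * gsum 5 (1 / 2) 0 \<tau>
     + of_real (2 * cos (3 * (pi * (3 / 5) / 2))) * gsum 5 (3 / 2) 0 \<tau>"
    by (rule theta_char_dissect[OF t])
  moreover have "pi * (3 / 5) / 2 = 3 * pi / 10" "3 * (pi * (3 / 5) / 2) = 9 * pi / 10" by simp_all
  ultimately show "theta_char 1 (3 / 5) 0 \<tau> = c3 * gsum 5 (1 / 2) 0 \<tau> - c1 * gsum 5 (3 / 2) 0 \<tau>"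
    by (simp only: cos_pi_tenth c1_def c3_def) simp
qed

lemma theta_constants:
  defines "c1 \<equiv> complex_of_real (2 * cos (pi / 10))" and "c3 \<equiv> complex_of_real (2 * cos (3 * pi / 10))"
  defines "s \<equiv> complex_of_real (sqrt 5)"
  shows "c1 * c3 = s" "c1 ^ 2 = (5 + s) / 2" "c3 ^ 2 = (5 - s) / 2" "s ^ 2 = 5" "s \<noteq> 0"
proof -
  show "c1 * c3 = s" unfolding c1_def c3_def s_def of_real_mult[symmetric] cos_pi_tenth ..
  show "c1 ^ 2 = (5 + s) / 2" "c3 ^ 2 = (5 - s) / 2"
    unfolding c1_def c3_def s_def of_real_power[symmetric] cos_pi_tenth by simp_all
  show "s ^ 2 = 5" "s \<noteq> 0" by (simp_all add: s_def flip: of_real_power)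
qed

text \<open>The product X Y is expanded in A and B: as c1 c3 = s and c3^2 - c1^2 = -s, a factor s
  comes out and cancels the sqrt 5 of \<open>theta_pair_product\<close>.\<close>

lemma gsum_quadratic:
  assumes t: "Im \<tau> > 0"
  defines "A \<equiv> gsum 5 (1 / 2) 0 \<tau>" and "B \<equiv> gsum 5 (3 / 2) 0 \<tau>"
  shows "A ^ 2 - A * B - B ^ 2 = exp (of_real pi * \<i> * \<tau> / 2) * qpoch_inf (qvar \<tau>) 1 * qpoch_inf (qvar \<tau> ^ 5) 1"
proof -
  let ?c1 = "complex_of_real (2 * cos (pi / 10))" and ?c3 = "complex_of_real (2 * cos (3 * pi / 10))"
  let ?s = "complex_of_real (sqrt 5)"
  note c = theta_constants
  have "(?c1 * A + ?c3 * B) * (?c3 * A - ?c1 * B) = ?c1 * ?c3 * (A ^ 2 - B ^ 2) + (?c3 ^ 2 - ?c1 ^ 2) * (A * B)"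
    by algebra
  also have "\<dots> = ?s * (A ^ 2 - A * B - B ^ 2)"
    unfolding c by (simp add: field_simps)
  finally have "?s * (A ^ 2 - A * B - B ^ 2) = ?s * (exp (of_real pi * \<i> * \<tau> / 2) * qpoch_inf (qvar \<tau>) 1 * qpoch_inf (qvar \<tau> ^ 5) 1)"
    using theta_pair_product[OF t] unfolding theta_chars_dissect[OF t] A_def B_def by (simp only: mult.assoc)
  then show ?thesis using c(5) by simp
qed

text \<open>The added exponent (pi i j / 5) (5 n + c / 2)^2 is pi i j c^2 / 20 plus pi i j (5 n^2 +
  c n), and 5 n^2 + c n is even for odd c.\<close>

lemma gsum_translate:
  fixes c :: nat
  assumes "odd c"
  shows "gsum 5 (of_nat c / 2) 0 (\<tau> + of_nat j / 5) = exp (of_real pi * \<i> / 20) ^ (j * c ^ 2) * gsum 5 (of_nat c / 2) 0 \<tau>"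
proof -
  have "gterm 5 (of_nat c / 2) 0 (\<tau> + of_nat j / 5) n = exp (of_real pi * \<i> / 20) ^ (j * c ^ 2) * gterm 5 (of_nat c / 2) 0 \<tau> n" for n
  proof -
    have "even (5 * n ^ 2 + int c * n)" using assms by simp
    then obtain k where k: "5 * n ^ 2 + int c * n = 2 * k" by (rule evenE)
    have k': "5 * of_int n ^ 2 + of_nat c * of_int n = (2 * of_int k :: complex)"
      using arg_cong[OF k, of complex_of_int]
      by (simp only: of_int_add of_int_mult of_int_power of_int_numeral of_int_of_nat_eq)
    have "of_real pi * \<i> * (\<tau> + of_nat j / 5) * of_real (5 * of_int n + of_nat c / 2) ^ 2 =
      of_real pi * \<i> * \<tau> * of_real (5 * of_int n + of_nat c / 2) ^ 2 + of_nat (j * c ^ 2) * (of_real pi * \<i> / 20)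
       + of_real pi * \<i> * of_nat j * (5 * of_int n ^ 2 + of_nat c * of_int n)"
      by (simp add: field_simps power2_eq_square)
    also have "of_real pi * \<i> * of_nat j * (5 * of_int n ^ 2 + of_nat c * of_int n) = 2 * of_int (int j * k) * of_real pi * \<i>"
      unfolding k' by simp
    finally have "exp (of_real pi * \<i> * (\<tau> + of_nat j / 5) * of_real (5 * of_int n + of_nat c / 2) ^ 2) =
      exp (of_real pi * \<i> * \<tau> * of_real (5 * of_int n + of_nat c / 2) ^ 2) * exp (of_nat (j * c ^ 2) * (of_real pi * \<i> / 20))
       * exp (2 * of_int (int j * k) * of_real pi * \<i>)"
      by (simp only: exp_add)
    also have "exp (2 * of_int (int j * k) * of_real pi * \<i>) = 1"
      using exp_integer_2pi[of "of_int (int j * k)"] by simp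
    finally show ?thesis
      unfolding gterm_def exp_of_nat_mult by (simp only: mult_ac mult_1)
  qed
  then have "gterm 5 (of_nat c / 2) 0 (\<tau> + of_nat j / 5) =
      (\<lambda>n. exp (of_real pi * \<i> / 20) ^ (j * c ^ 2) * gterm 5 (of_nat c / 2) 0 \<tau> n)" by blast
  then show ?thesis by (simp only: gsum_def infsum_cmult_right')
qed

text \<open>The product of \<open>gsum_quadratic\<close> over the translates \<open>\<tau> + j / 5\<close>, which multiply \<open>B / A\<close> by the fifth roots of unity.\<close>

theorem gsum_quintic:
  assumes t: "Im \<tau> > 0"
  defines "A \<equiv> gsum 5 (1 / 2) 0 \<tau>" and "B \<equiv> gsum 5 (3 / 2) 0 \<tau>"
  shows "(A ^ 10 - 11 * A ^ 5 * B ^ 5 - B ^ 10) * qpoch_inf (qvar \<tau> ^ 25) 1 =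
    exp (of_real pi * \<i> * \<tau> * (5 / 2)) * qpoch_inf (qvar \<tau> ^ 5) 1 ^ 11"
proof -
  define q where "q = qvar \<tau>"
  interpret nome q unfolding q_def using t by (rule nome_qvar)
  \<comment> \<open>The translation multiplies A by u^j and B by u^(9 j) = u^j w^j. By homogeneity
    u^j drops out and B is replaced by w^j B; the same w^j multiplies the nome.\<close>
  define u where "u = exp (of_real pi * \<i> / 20)"
  define w where "w = u ^ 8"
  define E where "E = exp (of_real pi * \<i> * \<tau> / 2)"
  have u0: "u \<noteq> 0" by (simp add: u_def)
  have w: "w = exp (2 * of_real pi * \<i> / 5)" by (simp add: w_def u_def mult_ac flip: exp_of_nat_mult)
  have "w ^ 5 = exp (of_nat 5 * (2 * of_real pi * \<i> / 5))"
    unfolding w exp_of_nat_mult ..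
  also have "of_nat 5 * (2 * of_real pi * \<i> / 5) = 2 * of_real pi * \<i>" by simp
  also have "exp (2 * of_real pi * \<i>) = 1" by (rule exp_two_pi_i)
  finally have w5: "w ^ 5 = 1" .
  have "Im w = sin (2 * pi / 5)" by (simp add: w Im_exp)
  moreover have "sin (2 * pi / 5) > 0" by (rule sin_gt_zero) simp_all
  ultimately have "w \<noteq> 1" by auto
  note ww = fifth_root_sum[OF w5 this]
  have key: "A ^ 2 - A * (w ^ j * B) - (w ^ j * B) ^ 2 = E * qpoch_inf (w ^ j * q) 1 * qpoch_inf (q ^ 5) 1" for j
  proof -
    have tj: "Im (\<tau> + of_nat j / 5) > 0" using t by simp
    have "gsum 5 (1 / 2) 0 (\<tau> + of_nat j / 5) = u ^ j * A"
      using gsum_translate[of 1 \<tau> j] by (simp add: A_def u_def)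
    moreover have "gsum 5 (3 / 2) 0 (\<tau> + of_nat j / 5) = u ^ j * (w ^ j * B)"
    proof -
      have "u ^ (j * 3 ^ 2) = u ^ j * w ^ j"
        by (simp add: w_def mult.commute flip: power_mult power_add)
      then show ?thesis
        using gsum_translate[of 3 \<tau> j] by (simp add: B_def u_def)
    qed
    moreover have "qvar (\<tau> + of_nat j / 5) = w ^ j * q"
      unfolding w q_def qvar_def exp_of_nat_mult[symmetric] exp_add[symmetric]
      by (simp add: algebra_simps)
    moreover have "(w ^ j * q) ^ 5 = q ^ 5"
    proof -
      have "(w ^ j) ^ 5 = 1" using w5 by (metis mult.commute power_mult power_one)
      then show ?thesis by (simp add: power_mult_distrib)
    qed
    moreover have "exp (of_real pi * \<i> * (\<tau> + of_nat j / 5) / 2) = (u ^ j) ^ 2 * E"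
      unfolding u_def E_def power_mult[symmetric] exp_of_nat_mult[symmetric] exp_add[symmetric]
      by (simp add: algebra_simps add_divide_distrib)
    ultimately have "(u ^ j * A) ^ 2 - (u ^ j * A) * (u ^ j * (w ^ j * B)) - (u ^ j * (w ^ j * B)) ^ 2 =
        (u ^ j) ^ 2 * E * qpoch_inf (w ^ j * q) 1 * qpoch_inf (q ^ 5) 1"
      using gsum_quadratic[OF tj] by simp
    then have "(u ^ j) ^ 2 * (A ^ 2 - A * (w ^ j * B) - (w ^ j * B) ^ 2) =
        (u ^ j) ^ 2 * (E * qpoch_inf (w ^ j * q) 1 * qpoch_inf (q ^ 5) 1)"
      by (simp add: algebra_simps power_mult_distrib power2_eq_square)
    then show ?thesis using u0 by simp
  qed
  have "A ^ 10 - 11 * A ^ 5 * B ^ 5 - B ^ 10 = E ^ 5 * qpoch_inf (q ^ 5) 1 ^ 5 *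
     (qpoch_inf q 1 * qpoch_inf (w * q) 1 * qpoch_inf (w ^ 2 * q) 1 * qpoch_inf (w ^ 3 * q) 1 * qpoch_inf (w ^ 4 * q) 1)"
  proof -
    have z5: "z ^ 5 = z * z * z * z * z" for z :: complex
      by (simp add: eval_nat_numeral mult.assoc)
    show ?thesis
      unfolding quadratic_norm_quintic[OF ww, symmetric] z5[of E] z5[of "qpoch_inf (q ^ 5) 1"]
        key[of 0, unfolded power_0 mult_1] key[of 1, unfolded power_one_right] key by (simp only: mult_ac)
  qed
  then have "(A ^ 10 - 11 * A ^ 5 * B ^ 5 - B ^ 10) * qpoch_inf (q ^ 25) 1 =
     E ^ 5 * qpoch_inf (q ^ 5) 1 ^ 5 * qpoch_inf (q ^ 5) 1 ^ 6"
    unfolding qpoch_roots_nome[OF ww, symmetric] by (simp only: mult_ac)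
  also have "\<dots> = E ^ 5 * qpoch_inf (q ^ 5) 1 ^ 11"
    by (simp flip: power_add)
  also have "E ^ 5 = exp (of_real pi * \<i> * \<tau> * (5 / 2))"
    by (simp add: E_def mult_ac flip: exp_of_nat_mult)
  finally show ?thesis by (simp add: q_def)
qed

text \<open>The form \<open>x y (x\<^sup>1\<^sup>0 - 11 x\<^sup>5 y\<^sup>5 - y\<^sup>1\<^sup>0)\<close> vanishes at the vertices of an icosahedron, which the linear map
  \<open>(A, B) \<mapsto> (X, Y)\<close> permutes; over the golden field it therefore permutes the quadratic factors.\<close>

lemma icosahedral_transform:
  fixes A B c1 c3 s :: complex
  assumes c: "c1 * c3 = s" "c1 ^ 2 = (5 + s) / 2" "c3 ^ 2 = (5 - s) / 2" "s ^ 2 = 5"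
  defines "X \<equiv> c1 * A + c3 * B" and "Y \<equiv> c3 * A - c1 * B"
  shows "X * Y * (X ^ 10 - 11 * X ^ 5 * Y ^ 5 - Y ^ 10) = 5 ^ 6 * (A * B * (A ^ 10 - 11 * A ^ 5 * B ^ 5 - B ^ 10))"
proof -
  define h where "h = (1 + s) / 2"
  have s: "s = 2 * h - 1" by (simp add: h_def field_simps)
  have h: "h ^ 2 = h + 1" using c(4) by (simp add: h_def field_simps power2_eq_square)
  then have hh: "h * h = h + 1" "h * (h * x) = h * x + x" for x
    by (simp_all add: power2_eq_square algebra_simps flip: mult.assoc)
  have c': "c1 * c3 = 2 * h - 1" "c1 ^ 2 = h + 2" "c3 ^ 2 = 3 - h"
    unfolding c by (simp_all add: s field_simps)
  let ?q = "\<lambda>u v x y :: complex. x ^ 2 + u * (x * y) + v * y ^ 2"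
  have sq: "X ^ 2 = (h + 2) * A ^ 2 + 2 * (2 * h - 1) * A * B + (3 - h) * B ^ 2"
      "Y ^ 2 = (3 - h) * A ^ 2 - 2 * (2 * h - 1) * A * B + (h + 2) * B ^ 2"
    and XY: "X * Y = (2 * h - 1) * ?q (- 1) (- 1) A B"
    unfolding X_def Y_def using c' by algebra+
  \<comment> \<open>The roots h w^i and h w^(-i) are paired, likewise those with 1 - h in place of
    h; 2 cos (2 pi / 5) = h - 1 and 2 cos (4 pi / 5) = - h keep the coefficients in the golden
    field.\<close>
  have fac: "x ^ 10 - 11 * x ^ 5 * y ^ 5 - y ^ 10 = ?q (- 1) (- 1) x y * ?q (- 1) (h + 1) x y
      * ?q (h + 1) (h + 1) x y * ?q (2 - h) (2 - h) x y * ?q (- 1) (2 - h) x y" for x y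
    using h by algebra
  \<comment> \<open>Up to constants the first factor changes places with x y, the third and fifth
    are exchanged, and the second and fourth stay. As (2 h - 1)^2 = 5 and (h + 1) (2 - h) = 1, the
    constants multiply to 5^6.\<close>
  have t1: "?q (- 1) (- 1) X Y = 5 * (2 * h - 1) * (A * B)"
    unfolding sq XY by (simp add: algebra_simps power2_eq_square hh)
  have t2: "?q (- 1) (h + 1) X Y = 5 * ?q (- 1) (h + 1) A B"
    unfolding sq XY by (simp add: algebra_simps power2_eq_square hh)
  have t3: "?q (h + 1) (h + 1) X Y = 5 * (h + 1) * ?q (- 1) (2 - h) A B"
    unfolding sq XY by (simp add: algebra_simps power2_eq_square hh)
  have t4: "?q (2 - h) (2 - h) X Y = 5 * ?q (2 - h) (2 - h) A B"
    unfolding sq XY by (simp add: algebra_simps power2_eq_square hh)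
  have t5: "?q (- 1) (2 - h) X Y = 5 * (2 - h) * ?q (h + 1) (h + 1) A B"
    unfolding sq XY by (simp add: algebra_simps power2_eq_square hh)
  have gen: "k * r0 * (5 * k * p * (5 * r1) * (5 * d * r4) * (5 * r3) * (5 * e * r2)) =
     5 ^ 5 * (k ^ 2 * (d * e)) * (p * (r0 * r1 * r2 * r3 * r4))" for k r0 r1 r2 r3 r4 p d e :: complex
    by algebra
  have "X * Y * (X ^ 10 - 11 * X ^ 5 * Y ^ 5 - Y ^ 10) =
     5 ^ 5 * ((2 * h - 1) ^ 2 * ((h + 1) * (2 - h))) * (A * B * (A ^ 10 - 11 * A ^ 5 * B ^ 5 - B ^ 10))"
    unfolding fac unfolding t1 t2 t3 t4 t5 unfolding XY by (rule gen)
  moreover have "(2 * h - 1) ^ 2 * ((h + 1) * (2 - h)) = 5" using h by algebra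
  ultimately show ?thesis by simp
qed

section \<open>The Riccati equation\<close>

lemma qpoch_inf_power: "qpoch_inf q k = qpoch_inf (q ^ k) 1"
  by (simp only: qpoch_inf_def mult_1 power_mult)

theorem mainTheorem6:
  fixes \<tau> :: complex
  assumes "Im \<tau> > 0"
  shows "(W5 has_field_derivative
           (2 * pi * \<i>) *
           ((1 / (complex_of_real (sqrt 5)) ^ 3) *
            (qpoch_inf (qvar \<tau>) 1 ^ 5 / qpoch_inf (qvar \<tau>) 5) *
            ((W5 \<tau>)\<^sup>2 - 11 * W5 \<tau> - 1))) (at \<tau>)"
proof -
  define c1 c3 s where "c1 = complex_of_real (2 * cos (pi / 10))"
    and "c3 = complex_of_real (2 * cos (3 * pi / 10))" and "s = complex_of_real (sqrt 5)"
  note c = theta_constants[folded c1_def c3_def s_def]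
  define A B where "A = gsum 5 (1 / 2) 0" and "B = gsum 5 (3 / 2) 0"
  define VA VB where "VA = gsum 5 (1 / 2) 2 \<tau>" and "VB = gsum 5 (3 / 2) 2 \<tau>"
  define X Y where "X = (\<lambda>t. c1 * A t + c3 * B t)" and "Y = (\<lambda>t. c3 * A t - c1 * B t)"
  define X' Y' where "X' = of_real pi * \<i> * (c1 * VA + c3 * VB)" and "Y' = of_real pi * \<i> * (c3 * VA - c1 * VB)"
  define Q1 Q5 Q25 where "Q1 = qpoch_inf (qvar \<tau>) 1" and "Q5 = qpoch_inf (qvar \<tau> ^ 5) 1"
    and "Q25 = qpoch_inf (qvar \<tau> ^ 25) 1"
  define E where "E = exp (of_real pi * \<i> * \<tau> / 2)"
  interpret nome "qvar \<tau>" using assms by (rule nome_qvar)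
  have Q_nz: "Q1 \<noteq> 0" "Q5 \<noteq> 0" "Q25 \<noteq> 0"
    unfolding Q1_def Q5_def Q25_def by (intro qpoch_nz nome.qpoch_nz nome_power; simp)+
  have E_nz: "E \<noteq> 0" by (simp add: E_def)
  have E5: "exp (of_real pi * \<i> * \<tau> * (5 / 2)) = E ^ 5"
    by (simp add: E_def mult_ac flip: exp_of_nat_mult)
  have th: "theta_char 1 (1 / 5) 0 t = X t" "theta_char 1 (3 / 5) 0 t = Y t" if "Im t > 0" for t
    using theta_chars_dissect[OF that] by (simp_all add: X_def Y_def A_def B_def c1_def c3_def)
  have W: "W5 t = X t ^ 5 / Y t ^ 5" if "Im t > 0" for t
    using th[OF that] by (simp add: W5_def)
  \<comment> \<open>The right side has no zero, so neither theta constant vanishes and the quotient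
    rule applies.\<close>
  have XY: "X \<tau> * Y \<tau> = s * E * Q1 * Q5"
    using theta_pair_product[OF assms] by (simp add: th[OF assms] s_def E_def Q1_def Q5_def)
  then have XY_nz: "X \<tau> \<noteq> 0" "Y \<tau> \<noteq> 0"
    using c(5) E_nz Q_nz by auto
  have AB: "A \<tau> * B \<tau> = E ^ 5 * Q25 * Q5"
    unfolding A_def B_def Q25_def Q5_def E5[symmetric] by (rule gsum_pair_product[OF assms])
  have G: "(A \<tau> ^ 10 - 11 * A \<tau> ^ 5 * B \<tau> ^ 5 - B \<tau> ^ 10) * Q25 = E ^ 5 * Q5 ^ 11"
    unfolding A_def B_def Q25_def Q5_def E5[symmetric] by (rule gsum_quintic[OF assms])
  define F where "F = X \<tau> ^ 10 - 11 * X \<tau> ^ 5 * Y \<tau> ^ 5 - Y \<tau> ^ 10"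
  have F: "X \<tau> * Y \<tau> * F = 5 ^ 6 * (A \<tau> * B \<tau> * (A \<tau> ^ 10 - 11 * A \<tau> ^ 5 * B \<tau> ^ 5 - B \<tau> ^ 10))"
    unfolding X_def Y_def F_def by (rule icosahedral_transform[OF c(1-4)])
  have wr: "X' * Y \<tau> - X \<tau> * Y' = 10 * (of_real pi * \<i>) * E ^ 5 * Q5 ^ 6"
  proof -
    have "c1 ^ 2 + c3 ^ 2 = 5" unfolding c by (simp add: field_simps)
    moreover have "A \<tau> * VB - B \<tau> * VA = 2 * E ^ 5 * Q5 ^ 6"
      unfolding A_def B_def VA_def VB_def Q5_def E5[symmetric] by (rule theta_wronskian[OF assms])
    moreover have "X' * Y \<tau> - X \<tau> * Y' = of_real pi * \<i> * ((c1 ^ 2 + c3 ^ 2) * (A \<tau> * VB - B \<tau> * VA))"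
      unfolding X'_def Y'_def X_def Y_def by algebra
    ultimately show ?thesis by simp
  qed
  \<comment> \<open>What the Riccati equation demands once the quotient rule has given 5 (X Y)^4 (X'
    Y - X Y') / Y^10. In eta functions it says F = 5^6 eta(5 tau)^12 / (X Y); multiplication by X Y
    Q25 avoids divisions, and 5^6 = 25 s^8 settles the constant.\<close>
  have key: "25 * s ^ 3 * (X \<tau> * Y \<tau>) ^ 4 * E ^ 5 * Q5 ^ 7 = Q1 ^ 5 * F"
  proof -
    have "s ^ 8 = (s ^ 2) ^ 4" by (simp flip: power_mult)
    then have s8: "s ^ 8 = 5 ^ 4" by (simp only: c(4))
    have "(X \<tau> * Y \<tau> * Q25) * (Q1 ^ 5 * F) = Q1 ^ 5 * Q25 * (X \<tau> * Y \<tau> * F)"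
      by (simp only: mult_ac)
    also have "\<dots> = 5 ^ 6 * Q1 ^ 5 * (A \<tau> * B \<tau>) * ((A \<tau> ^ 10 - 11 * A \<tau> ^ 5 * B \<tau> ^ 5 - B \<tau> ^ 10) * Q25)"
      unfolding F by (simp only: mult_ac)
    also have "\<dots> = 5 ^ 6 * Q1 ^ 5 * (E ^ 5 * Q25 * Q5) * (E ^ 5 * Q5 ^ 11)"
      unfolding AB G ..
    also have "\<dots> = 25 * s ^ 8 * E ^ 10 * Q1 ^ 5 * Q5 ^ 12 * Q25"
      unfolding s8 by algebra
    also have "\<dots> = (s * E * Q1 * Q5) * Q25 * (25 * s ^ 3 * (s * E * Q1 * Q5) ^ 4 * E ^ 5 * Q5 ^ 7)"
      by algebra
    also have "\<dots> = (X \<tau> * Y \<tau> * Q25) * (25 * s ^ 3 * (X \<tau> * Y \<tau>) ^ 4 * E ^ 5 * Q5 ^ 7)"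
      unfolding XY ..
    finally show ?thesis using XY_nz Q_nz by simp
  qed
  have "(A has_field_derivative of_real pi * \<i> * VA) (at \<tau>)" "(B has_field_derivative of_real pi * \<i> * VB) (at \<tau>)"
    unfolding A_def B_def VA_def VB_def using assms by (auto intro!: gsum_deriv)
  then have "(X has_field_derivative X') (at \<tau>)" "(Y has_field_derivative Y') (at \<tau>)"
    unfolding X_def Y_def X'_def Y'_def by (auto intro!: derivative_eq_intros simp: algebra_simps)
  then have "((\<lambda>t. X t ^ 5 / Y t ^ 5) has_field_derivative
      ((5 * X \<tau> ^ 4 * X') * Y \<tau> ^ 5 - X \<tau> ^ 5 * (5 * Y \<tau> ^ 4 * Y')) / (Y \<tau> ^ 5 * Y \<tau> ^ 5)) (at \<tau>)"
    using XY_nz by (auto intro!: derivative_eq_intros)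
  also have "((5 * X \<tau> ^ 4 * X') * Y \<tau> ^ 5 - X \<tau> ^ 5 * (5 * Y \<tau> ^ 4 * Y')) / (Y \<tau> ^ 5 * Y \<tau> ^ 5) =
     (2 * pi * \<i>) * ((1 / s ^ 3) * (Q1 ^ 5 / Q5) * ((W5 \<tau>)\<^sup>2 - 11 * W5 \<tau> - 1))"
  proof -
    have "(W5 \<tau>)\<^sup>2 - 11 * W5 \<tau> - 1 = F / Y \<tau> ^ 10"
      unfolding W[OF assms] F_def using XY_nz by (simp add: field_simps flip: power_mult power_add)
    then have "(2 * pi * \<i>) * ((1 / s ^ 3) * (Q1 ^ 5 / Q5) * ((W5 \<tau>)\<^sup>2 - 11 * W5 \<tau> - 1)) =
      (2 * pi * \<i>) * (Q1 ^ 5 * F) / (s ^ 3 * Q5 * Y \<tau> ^ 10)"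
      by simp
    also have "\<dots> = (2 * pi * \<i>) * (25 * (X \<tau> * Y \<tau>) ^ 4 * E ^ 5 * Q5 ^ 6) / Y \<tau> ^ 10"
      unfolding key[symmetric] using c(5) Q_nz XY_nz by (simp add: divide_simps) algebra
    also have "\<dots> = 5 * (X \<tau> * Y \<tau>) ^ 4 * (X' * Y \<tau> - X \<tau> * Y') / Y \<tau> ^ 10"
      unfolding wr by simp
    also have "5 * (X \<tau> * Y \<tau>) ^ 4 * (X' * Y \<tau> - X \<tau> * Y') = (5 * X \<tau> ^ 4 * X') * Y \<tau> ^ 5 - X \<tau> ^ 5 * (5 * Y \<tau> ^ 4 * Y')"
      by algebra
    also have "Y \<tau> ^ 10 = Y \<tau> ^ 5 * Y \<tau> ^ 5" by (simp flip: power_add)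
    finally show ?thesis by (rule sym)
  qed
  finally have "((\<lambda>t. X t ^ 5 / Y t ^ 5) has_field_derivative
     (2 * pi * \<i>) * ((1 / s ^ 3) * (Q1 ^ 5 / Q5) * ((W5 \<tau>)\<^sup>2 - 11 * W5 \<tau> - 1))) (at \<tau>)" .
  moreover have "open {t. Im t > 0}" by (rule open_halfspace_Im_gt)
  ultimately have "(W5 has_field_derivative
     (2 * pi * \<i>) * ((1 / s ^ 3) * (Q1 ^ 5 / Q5) * ((W5 \<tau>)\<^sup>2 - 11 * W5 \<tau> - 1))) (at \<tau>)"
    by (rule has_field_derivative_transform_within_open) (use assms W in auto)
  then show ?thesis
    unfolding s_def Q1_def Q5_def qpoch_inf_power[of _ 5] .
qed

end
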